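(* Let $T=\{1234,2341,4123\}$ and let $F_T(x)=\sum_{n\ge0}|S_n(T)|x^n$. Then $$F_T(x)=\frac{1-11x+51x^2-130x^3+199x^4-183x^5+91x^6-15x^7-6x^8+4x^9}{(1-x)^7(1-2x)^2}+\frac{1+x}{1-x}\big(C(x)-1\big),$$ where $C(x)=\frac{1-\sqrt{1-4x}}{2x}$.
   Context: $S_n$ is the set of permutations of $[n]$ ($S_0$ contains the empty permutation). A permutation avoids a pattern $\tau$ if it has no subsequence order-isomorphic to $\tau$; $S_n(T)$ is the set of permutations in $S_n$ avoiding every pattern in $T$. $C(x)$ is the Catalan generating function. *)

theory Defs
  imports
    Complex_Main
    "HOL-Library.Sublist"
    "HOL-Combinatorics.Multiset_Permutations"
    "HOL-Computational_Algebra.Formal_Power_Series"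
begin

text \<open>Permutations of \<open>{1..n}\<close> are given in one-line notation, as elements of
  \<^term>\<open>permutations_of_set {1..n}\<close>. A subsequence need not be contiguous.\<close>

definition order_isomorphic :: "nat list \<Rightarrow> nat list \<Rightarrow> bool" where
  "order_isomorphic xs ys \<longleftrightarrow> length xs = length ys \<and>
     (\<forall>i<length xs. \<forall>j<length xs. xs ! i < xs ! j \<longleftrightarrow> ys ! i < ys ! j)"

definition avoids :: "nat list \<Rightarrow> nat list \<Rightarrow> bool" where
  "avoids \<pi> \<tau> \<longleftrightarrow> \<not> (\<exists>xs. subseq xs \<pi> \<and> order_isomorphic xs \<tau>)"

definition avoiders :: "nat \<Rightarrow> nat list set \<Rightarrow> nat list set" where
  "avoiders n T = {\<pi> \<in> permutations_of_set {1..n}. \<forall>\<tau>\<in>T. avoids \<pi> \<tau>}"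

definition avoiders_gf :: "nat list set \<Rightarrow> real fps" where
  "avoiders_gf T = Abs_fps (\<lambda>n. real (card (avoiders n T)))"

text \<open>The square root is the formal one with constant term \<open>root 2 1 = 1\<close>. Since
  \<open>2 * fps_X\<close> is not a unit, the quotient is a division of power series with shift; it is
  exact by \<open>catalan_gf_exact\<close> below.\<close>

definition catalan_gf :: "real fps" where
  "catalan_gf = (1 - fps_radical root 2 (1 - 4 * fps_X)) / (2 * fps_X)"

lemma fps_sqrt_catalan: "fps_radical root 2 (1 - 4 * fps_X :: real fps) ^ 2 = 1 - 4 * fps_X"
  using power_radical[of "1 - 4 * fps_X :: real fps" root 1]
  by (simp add: numeral_2_eq_2)

lemma catalan_gf_exact: "2 * fps_X * catalan_gf = 1 - fps_radical root 2 (1 - 4 * fps_X)"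
proof -
  let ?s = "fps_radical root 2 (1 - 4 * fps_X :: real fps)"
  have "fps_nth (1 - ?s) 0 = 0"
    by simp
  then have "1 - ?s = 0 \<or> 1 \<le> subdegree (1 - ?s)"
    using subdegree_geI[of "1 - ?s" 1] by (metis less_one)
  then have "fps_X dvd 1 - ?s"
    by (metis dvd_0_right fps_X_neq_zero fps_dvd_iff subdegree_fps_X)
  moreover have "is_unit (2 :: real fps)"
    by (simp add: fps_is_unit_iff)
  ultimately have "2 * fps_X dvd 1 - ?s"
    by (simp add: mult_unit_dvd_iff')
  then show ?thesis
    unfolding catalan_gf_def by (rule dvd_mult_div_cancel)
qed

end

(* Build permutations by inserting the new maximum N into a permutation of {1..N-1}. In a new
   occurrence of 1234, 2341 or 4123 the entry N plays the role of 4, so inserting N at site i is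
   harmless iff the prefix before i and the suffix after i contain no 123 and no ascent a < b of
   the prefix is followed, after i, by an entry below a. After an insertion at an allowed site i, an
   allowed site s <= i survives iff the entries between s and i are decreasing, and an allowed site
   s >= i survives iff the prefix before i is decreasing and lies below the suffix after s.
   Hence the generating tree depends only on the allowed sites, on which of the stretches between
   them are decreasing, and on which suffixes lie above the first entry. The patterns that arise are
   described by at most four integers each, which turns the generating tree into a
   linear system over power series. Such a system has only one solution, so it suffices to verify
   closed forms in U = 1/(1-x), V = 1/(1-2x) and C, using x C^2 = C - 1. *)
theory Submission
  imports Defs
begin

section \<open>Insertion of a new maximum\<close>

text \<open>Among the allowed sites beyond the initial decreasing run, those reached from the run by
  a decreasing stretch form an initial segment, and those whose suffix lies above the first entry
  form a final segment. The sizes of two such segments determine the size of their intersection, so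
  counts of sites suffice and their positions can be forgotten. The four-parameter state
  \<open>StB k q x r\<close> is never solved in general. From the empty permutation only the shapes
  (q,x,r) = (1,0,1), (q,0,1), (q,0,q), (q,1,1), (1,1,1), (q,q,1), (q,1,q) are reached, and apart
  from recursion within a shape they depend on each other without cycles. The closed forms have
  simple origins. The rule "label q has children 1..q" gives U^q, and the Catalan rule "children
  1..q+1" gives C^(q+1). A recurrence f_k = s_k + x f_(k+1) multiplies a constant source by U, a
  source C^k by 1/(1-xC) = C, and a source U^k by 1/(1-xU) = (1-x)V.\<close>

definition has123 :: "nat list \<Rightarrow> bool" where
  "has123 l \<longleftrightarrow> (\<exists>a b c. subseq [a, b, c] l \<and> a < b \<and> b < c)"

definition avoider :: "nat list \<Rightarrow> bool" where
  "avoider l \<longleftrightarrow> \<not> (\<exists>a b c d. subseq [a, b, c, d] l \<and>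
     (a < b \<and> b < c \<and> c < d \<or> d < a \<and> a < b \<and> b < c \<or> b < c \<and> c < d \<and> d < a))"

definition insertable :: "nat list \<Rightarrow> nat list \<Rightarrow> bool" where
  "insertable l r \<longleftrightarrow> \<not> has123 l \<and> \<not> has123 r \<and>
     \<not> (\<exists>a b d. subseq [a, b] l \<and> a < b \<and> d \<in> set r \<and> d < a)"

lemma length_4_conv: "length xs = 4 \<longleftrightarrow> (\<exists>a b c d. xs = [a, b, c, d])"
  by (auto simp: numeral_eq_Suc length_Suc_conv)

lemma order_isomorphic_4:
  "order_isomorphic [a, b, c, d] [p, q, r, s] \<longleftrightarrow>
    (a < b \<longleftrightarrow> p < q) \<and> (b < a \<longleftrightarrow> q < p) \<and> (a < c \<longleftrightarrow> p < r) \<and> (c < a \<longleftrightarrow> r < p) \<and>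
    (a < d \<longleftrightarrow> p < s) \<and> (d < a \<longleftrightarrow> s < p) \<and> (b < c \<longleftrightarrow> q < r) \<and> (c < b \<longleftrightarrow> r < q) \<and>
    (b < d \<longleftrightarrow> q < s) \<and> (d < b \<longleftrightarrow> s < q) \<and> (c < d \<longleftrightarrow> r < s) \<and> (d < c \<longleftrightarrow> s < r)"
  unfolding order_isomorphic_def by (simp add: All_less_Suc) (rule iffI; elim conjE; intro conjI; assumption)

lemma ex_order_isomorphic_4:
  "(\<exists>xs. subseq xs l \<and> order_isomorphic xs [p, q, r, s]) \<longleftrightarrow>
    (\<exists>a b c d. subseq [a, b, c, d] l \<and> order_isomorphic [a, b, c, d] [p, q, r, s])"
proof
  assume "\<exists>xs. subseq xs l \<and> order_isomorphic xs [p, q, r, s]"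
  then obtain xs where xs: "subseq xs l" "order_isomorphic xs [p, q, r, s]" by blast
  then have "length xs = 4" by (simp add: order_isomorphic_def)
  then obtain a b c d where "xs = [a, b, c, d]" unfolding length_4_conv by blast
  with xs show "\<exists>a b c d. subseq [a, b, c, d] l \<and> order_isomorphic [a, b, c, d] [p, q, r, s]"
    by blast
qed blast

lemma order_isomorphic_1234:
  "order_isomorphic [a, b, c, d] [1,2,3,4] \<longleftrightarrow> a < b \<and> b < c \<and> c < d"
  unfolding order_isomorphic_4 by auto

lemma order_isomorphic_2341:
  "order_isomorphic [a, b, c, d] [2,3,4,1] \<longleftrightarrow> d < a \<and> a < b \<and> b < c"
  unfolding order_isomorphic_4 by auto

lemma order_isomorphic_4123:
  "order_isomorphic [a, b, c, d] [4,1,2,3] \<longleftrightarrow> b < c \<and> c < d \<and> d < a"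
  unfolding order_isomorphic_4 by auto

lemma avoids_iff_avoider:
  "(\<forall>\<tau>\<in>{[1,2,3,4], [2,3,4,1], [4,1,2,3]}. avoids \<pi> \<tau>) \<longleftrightarrow> avoider \<pi>"
  unfolding avoids_def avoider_def ball_simps ex_order_isomorphic_4
    order_isomorphic_1234 order_isomorphic_2341 order_isomorphic_4123
  by blast

section \<open>Subsequences and patterns after inserting one entry\<close>

lemma subseq_insert:
  assumes "x \<notin> set l" "x \<notin> set r"
  shows "subseq zs (l @ x # r) \<longleftrightarrow>
    subseq zs (l @ r) \<or> (\<exists>us vs. zs = us @ x # vs \<and> subseq us l \<and> subseq vs r)"
proof
  assume "subseq zs (l @ x # r)"
  then obtain us ws where zs: "zs = us @ ws" "subseq us l" "subseq ws (x # r)"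
    by (meson subseq_appendE)
  show "subseq zs (l @ r) \<or> (\<exists>us vs. zs = us @ x # vs \<and> subseq us l \<and> subseq vs r)"
  proof (cases "subseq ws r")
    case True
    then show ?thesis using zs by (auto intro: list_emb_append_mono)
  next
    case False
    then obtain vs where "ws = x # vs" "subseq vs r"
      using zs(3) by (cases ws) (auto split: if_splits)
    then show ?thesis using zs by blast
  qed
next
  assume "subseq zs (l @ r) \<or> (\<exists>us vs. zs = us @ x # vs \<and> subseq us l \<and> subseq vs r)"
  then show "subseq zs (l @ x # r)"
  proof
    assume "subseq zs (l @ r)"
    then obtain us vs where "zs = us @ vs" "subseq us l" "subseq vs r"
      by (meson subseq_appendE)
    then show ?thesis by (auto intro!: list_emb_append_mono)
  qed (auto intro!: list_emb_append_mono)
qed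

text \<open>Applied once per entry, this enumerates the possible positions of \<open>x\<close> in an
  explicit list; it produces the case lists for lengths 2, 3 and 4 below.\<close>

lemma Cons_split_ex:
  "(\<exists>us vs. z # zs = us @ x # vs \<and> P us vs) \<longleftrightarrow>
     (z = x \<and> P [] zs) \<or> (\<exists>us vs. zs = us @ x # vs \<and> P (z # us) vs)"
  by (auto simp: Cons_eq_append_conv)

lemma subseq2_insert:
  assumes "x \<notin> set l" "x \<notin> set r"
  shows "subseq [a, b] (l @ x # r) \<longleftrightarrow>
    subseq [a, b] (l @ r) \<or> a = x \<and> b \<in> set r \<or> b = x \<and> a \<in> set l"
  unfolding subseq_insert[OF assms] Cons_split_ex
  by (simp add: subseq_singleton_left)

lemma subseq3_insert:
  assumes "x \<notin> set l" "x \<notin> set r"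
  shows "subseq [a, b, c] (l @ x # r) \<longleftrightarrow>
    subseq [a, b, c] (l @ r) \<or> a = x \<and> subseq [b, c] r
    \<or> b = x \<and> a \<in> set l \<and> c \<in> set r \<or> c = x \<and> subseq [a, b] l"
  unfolding subseq_insert[OF assms] Cons_split_ex
  by (simp add: subseq_singleton_left)

lemma subseq4_insert:
  assumes "x \<notin> set l" "x \<notin> set r"
  shows "subseq [a, b, c, d] (l @ x # r) \<longleftrightarrow>
    subseq [a, b, c, d] (l @ r) \<or> a = x \<and> subseq [b, c, d] r
    \<or> b = x \<and> a \<in> set l \<and> subseq [c, d] r \<or> c = x \<and> subseq [a, b] l \<and> d \<in> set r
    \<or> d = x \<and> subseq [a, b, c] l"
  unfolding subseq_insert[OF assms] Cons_split_ex
  by (simp add: subseq_singleton_left)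

lemma subseq_set: "subseq xs ys \<Longrightarrow> set xs \<subseteq> set ys"
  using set_subseqs_eq subseqs_powset by (metis PowD image_eqI in_set_subseqs)

text \<open>The maximum can only be the last entry of an increasing triple.\<close>

lemma has123_insert_max:
  assumes "\<forall>y\<in>set l \<union> set r. y < x"
  shows "has123 (l @ x # r) \<longleftrightarrow> has123 (l @ r) \<or> (\<exists>a b. subseq [a, b] l \<and> a < b)"
proof -
  have x: "x \<notin> set l" "x \<notin> set r" using assms by auto
  have l: "y < x" if "y \<in> set l" for y using assms that by blast
  have r: "y < x" if "y \<in> set r" for y using assms that by blast
  have l2: "a < x" "b < x" if "subseq [a, b] l" for a b
    using subseq_set[OF that] l by auto
  have r2: "a < x" "b < x" if "subseq [a, b] r" for a b
    using subseq_set[OF that] r by auto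
  show ?thesis
  proof
    assume "has123 (l @ x # r)"
    then obtain a b c where "subseq [a, b, c] (l @ x # r)" and abc: "a < b" "b < c"
      unfolding has123_def by blast
    then have "subseq [a, b, c] (l @ r) \<or> subseq [a, b] l"
      unfolding subseq3_insert[OF x] using r[of c] r2[of b c] by auto
    then show "has123 (l @ r) \<or> (\<exists>a b. subseq [a, b] l \<and> a < b)"
      unfolding has123_def using abc by blast
  next
    assume "has123 (l @ r) \<or> (\<exists>a b. subseq [a, b] l \<and> a < b)"
    then show "has123 (l @ x # r)"
    proof
      assume "has123 (l @ r)"
      then show ?thesis unfolding has123_def subseq3_insert[OF x] by blast
    next
      assume "\<exists>a b. subseq [a, b] l \<and> a < b"
      then obtain a b where "subseq [a, b] l" "a < b" by blast
      then have "subseq [a, b, x] (l @ x # r)" "a < b" "b < x"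
        using l2 by (simp_all add: subseq3_insert[OF x])
      then show ?thesis unfolding has123_def by blast
    qed
  qed
qed

lemma avoider_insert_max:
  assumes "\<forall>y\<in>set l \<union> set r. y < x"
  shows "avoider (l @ x # r) \<longleftrightarrow> avoider (l @ r) \<and> insertable l r"
proof -
  have x: "x \<notin> set l" "x \<notin> set r" using assms by auto
  have l: "y < x" if "y \<in> set l" for y using assms that by blast
  have r: "y < x" if "y \<in> set r" for y using assms that by blast
  have l2: "a < x" "b < x" if "subseq [a, b] l" for a b
    using subseq_set[OF that] l by auto
  have r2: "a < x" "b < x" if "subseq [a, b] r" for a b
    using subseq_set[OF that] r by auto
  have l3: "a < x" "b < x" "c < x" if "subseq [a, b, c] l" for a b c
    using subseq_set[OF that] l by auto
  have r3: "a < x" "b < x" "c < x" if "subseq [a, b, c] r" for a b c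
    using subseq_set[OF that] r by auto
  show ?thesis
  proof
    assume av: "avoider (l @ x # r)"
    then have no: "\<not> (a < b \<and> b < c \<and> c < d \<or> d < a \<and> a < b \<and> b < c \<or> b < c \<and> c < d \<and> d < a)"
      if "subseq [a, b, c, d] (l @ x # r)" for a b c d
      using that unfolding avoider_def by blast
    have "subseq [a, b, c, d] (l @ x # r)" if "subseq [a, b, c, d] (l @ r)" for a b c d
      using that by (simp add: subseq4_insert[OF x])
    then have h1: "avoider (l @ r)"
      unfolding avoider_def using no by (intro notI) (elim exE conjE, blast)
    have h2: "\<not> has123 l"
    proof
      assume "has123 l"
      then obtain a b c where "subseq [a, b, c] l" "a < b" "b < c"
        unfolding has123_def by blast
      then show False using no[of a b c x] l3[of a b c] by (simp add: subseq4_insert[OF x])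
    qed
    have h3: "\<not> has123 r"
    proof
      assume "has123 r"
      then obtain a b c where "subseq [a, b, c] r" "a < b" "b < c"
        unfolding has123_def by blast
      then show False using no[of x a b c] r3[of a b c] by (simp add: subseq4_insert[OF x])
    qed
    have h4: "\<not> (\<exists>a b d. subseq [a, b] l \<and> a < b \<and> d \<in> set r \<and> d < a)"
    proof (rule notI, elim exE conjE)
      fix a b d
      assume "subseq [a, b] l" "a < b" "d \<in> set r" "d < a"
      then show False using no[of a b x d] l2[of a b] by (simp add: subseq4_insert[OF x])
    qed
    show "avoider (l @ r) \<and> insertable l r"
      unfolding insertable_def using h1 h2 h3 h4 by (intro conjI)
  next
    assume as: "avoider (l @ r) \<and> insertable l r"
    show "avoider (l @ x # r)"
      unfolding avoider_def
    proof (rule notI, elim exE conjE)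
      fix a b c d
      assume sub: "subseq [a, b, c, d] (l @ x # r)"
        and pat: "a < b \<and> b < c \<and> c < d \<or> d < a \<and> a < b \<and> b < c \<or> b < c \<and> c < d \<and> d < a"
      \<comment> \<open>Every pattern has its second entry below its third, which excludes the
        maximum as second entry.\<close>
      have pat': "a < b \<and> b < c \<or> b < c \<and> c < d" using pat by auto
      from sub[unfolded subseq4_insert[OF x]] show False
      proof (elim disjE conjE)
        assume "subseq [a, b, c, d] (l @ r)"
        then show False using as pat unfolding avoider_def by blast
      next
        assume "a = x" "subseq [b, c, d] r"
        moreover from this have "b < c" "c < d" using pat r3[of b c d] by auto
        ultimately have "has123 r" unfolding has123_def by blast
        then show False using as by (simp add: insertable_def)
      next
        assume "b = x" "a \<in> set l" "subseq [c, d] r"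
        then show False using pat' r2[of c d] by auto
      next
        assume "c = x" "subseq [a, b] l" "d \<in> set r"
        moreover from this have "a < b" "d < a" using pat r[of d] by auto
        ultimately show False using as unfolding insertable_def by blast
      next
        assume "d = x" "subseq [a, b, c] l"
        moreover from this have "a < b" "b < c" using pat l3[of a b c] by auto
        ultimately have "has123 l" unfolding has123_def by blast
        then show False using as by (simp add: insertable_def)
      qed
    qed
  qed
qed

section \<open>Allowed sites, decreasing stretches and good suffixes\<close>

definition ins :: "nat \<Rightarrow> nat \<Rightarrow> nat list \<Rightarrow> nat list" where
  "ins i x \<pi> = take i \<pi> @ x # drop i \<pi>"

definition sites :: "nat list \<Rightarrow> nat set" where
  "sites \<pi> = {i. i \<le> length \<pi> \<and> insertable (take i \<pi>) (drop i \<pi>)}"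

text \<open>Sites are gaps: the stretch between sites \<open>s\<close> and \<open>t\<close> consists
  of the entries at positions \<open>s\<close> to \<open>t - 1\<close>, counted from 0. It is
  vacuously decreasing when \<open>t\<close> is at most \<open>s + 1\<close>.\<close>

definition dec :: "nat list \<Rightarrow> nat \<Rightarrow> nat \<Rightarrow> bool" where
  "dec \<pi> s t \<longleftrightarrow> sorted_wrt (>) (drop s (take t \<pi>))"

text \<open>In a decreasing prefix the first entry is the largest, so one comparison with the first
  entry replaces the condition that the whole prefix lies below the suffix. The end of the
  permutation is vacuously good.\<close>

definition good :: "nat list \<Rightarrow> nat \<Rightarrow> bool" where
  "good \<pi> s \<longleftrightarrow> (\<forall>d\<in>set (drop s \<pi>). hd \<pi> < d)"

lemma finite_sites [simp]: "finite (sites \<pi>)"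
  by (rule finite_subset[of _ "{..length \<pi>}"]) (auto simp: sites_def)

lemma sites_le_length: "s \<in> sites \<pi> \<Longrightarrow> s \<le> length \<pi>"
  by (simp add: sites_def)

lemma length_ins [simp]: "length (ins i x \<pi>) = Suc (length \<pi>)"
  by (simp add: ins_def)

lemma sorted_wrt_greater_iff:
  "distinct l \<Longrightarrow> sorted_wrt (>) l \<longleftrightarrow> \<not> (\<exists>a b. subseq [a, b] l \<and> a < b)" for l :: "nat list"
proof (induction l)
  case (Cons y l)
  have "(\<exists>a b. subseq [a, b] (y # l) \<and> a < b) \<longleftrightarrow>
      (\<exists>b\<in>set l. y < b) \<or> (\<exists>a b. subseq [a, b] l \<and> a < b)"
  proof -
    have *: "subseq [a, b] (y # l) \<longleftrightarrow> a = y \<and> b \<in> set l \<or> subseq [a, b] l" for a b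
      using subseq2_insert[of y "[]" l a b] Cons.prems by auto
    show ?thesis unfolding * by blast
  qed
  moreover have "(\<forall>b\<in>set l. b < y) \<longleftrightarrow> \<not> (\<exists>b\<in>set l. y < b)"
    using Cons.prems by (metis distinct.simps(2) less_asym nat_neq_iff)
  ultimately show ?case using Cons by simp
qed simp

lemma sorted_wrt_greater_insert_max:
  fixes x :: nat
  assumes "\<forall>y\<in>set l \<union> set r. y < x"
  shows "sorted_wrt (>) (l @ x # r) \<longleftrightarrow> l = [] \<and> sorted_wrt (>) r"
  using assms by (cases l) (auto simp: sorted_wrt_append)

lemma dec_iff:
  assumes "t \<le> length \<pi>"
  shows "dec \<pi> s t \<longleftrightarrow> (\<forall>i j. s \<le> i \<longrightarrow> i < j \<longrightarrow> j < t \<longrightarrow> \<pi> ! j < \<pi> ! i)"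
proof
  assume "dec \<pi> s t"
  then have *: "drop s (take t \<pi>) ! b < drop s (take t \<pi>) ! a" if "a < b" "b < t - s" for a b
    using that assms unfolding dec_def sorted_wrt_iff_nth_less by simp
  show "\<forall>i j. s \<le> i \<longrightarrow> i < j \<longrightarrow> j < t \<longrightarrow> \<pi> ! j < \<pi> ! i"
  proof (intro allI impI)
    fix i j assume "s \<le> i" "i < j" "j < t"
    then show "\<pi> ! j < \<pi> ! i" using *[of "i - s" "j - s"] assms by simp
  qed
next
  assume "\<forall>i j. s \<le> i \<longrightarrow> i < j \<longrightarrow> j < t \<longrightarrow> \<pi> ! j < \<pi> ! i"
  then show "dec \<pi> s t"
    unfolding dec_def sorted_wrt_iff_nth_less using assms by simp
qed

lemma dec_mono:
  assumes "dec \<pi> s t" "s \<le> s'" "t' \<le> t" "t \<le> length \<pi>"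
  shows "dec \<pi> s' t'"
proof -
  have "t' \<le> length \<pi>" using assms by simp
  then show ?thesis using assms by (simp add: dec_iff)
qed

text \<open>The two stretches share the entry at position \<open>s'\<close>, through which an
  earlier entry of the first is compared with a later entry of the second.\<close>

lemma dec_glue:
  assumes "dec \<pi> s t" "dec \<pi> s' t'" "s \<le> s'" "s' < t" "t \<le> t'" "t' \<le> length \<pi>"
  shows "dec \<pi> s t'"
proof -
  have 1: "\<pi> ! j < \<pi> ! i" if "s \<le> i" "i < j" "j < t" for i j
    using assms that by (simp add: dec_iff)
  have 2: "\<pi> ! j < \<pi> ! i" if "s' \<le> i" "i < j" "j < t'" for i j
    using assms that by (simp add: dec_iff)
  have "\<pi> ! j < \<pi> ! i" if "s \<le> i" "i < j" "j < t'" for i j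
  proof (cases "j < t \<or> s' \<le> i")
    case False
    then have "\<pi> ! s' < \<pi> ! i" "\<pi> ! j < \<pi> ! s'"
      using 1[of i s'] 2[of s' j] assms(4) that by simp_all
    then show ?thesis by simp
  qed (use 1 2 that in blast)
  then show ?thesis using assms(6) by (simp add: dec_iff)
qed

lemma dec_self [simp]: "dec \<pi> s s"
  by (simp add: dec_def)

lemma good_mono: "good \<pi> s \<Longrightarrow> s \<le> t \<Longrightarrow> good \<pi> t"
  unfolding good_def by (meson in_mono set_drop_subset_set_drop)

lemma good_length [simp]: "good \<pi> (length \<pi>)"
  by (simp add: good_def)

text \<open>The suffix after \<open>s\<close> still contains the entry at position \<open>s\<close>,
  which belongs to the decreasing run and so does not exceed the first entry.\<close>

lemma not_good_dec:
  assumes "dec \<pi> 0 k" "s < k" "k \<le> length \<pi>"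
  shows "\<not> good \<pi> s"
proof
  assume "good \<pi> s"
  moreover have "\<pi> ! s \<in> set (drop s \<pi>)"
    using assms by (metis Cons_nth_drop_Suc list.set_intros(1) order_less_le_trans)
  ultimately have "hd \<pi> < \<pi> ! s" by (simp add: good_def)
  moreover have "hd \<pi> = \<pi> ! 0" using assms by (cases \<pi>) auto
  moreover have "\<pi> ! s \<le> \<pi> ! 0"
    using assms by (cases "s = 0") (auto simp: dec_iff less_imp_le)
  ultimately show False by simp
qed

lemma take_ins_left: "s \<le> i \<Longrightarrow> i \<le> length \<pi> \<Longrightarrow> take s (ins i x \<pi>) = take s \<pi>"
  by (simp add: ins_def min_absorb1)

lemma drop_ins_left:
  "s \<le> i \<Longrightarrow> i \<le> length \<pi> \<Longrightarrow> drop s (ins i x \<pi>) = drop s (take i \<pi>) @ x # drop i \<pi>"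
  by (simp add: ins_def)

lemma take_ins_right:
  assumes "i \<le> s" "i \<le> length \<pi>"
  shows "take (Suc s) (ins i x \<pi>) = take i \<pi> @ x # drop i (take s \<pi>)"
  using assms by (simp add: ins_def min_absorb2 Suc_diff_le take_drop)

lemma drop_ins_right:
  assumes "i \<le> s" "i \<le> length \<pi>"
  shows "drop (Suc s) (ins i x \<pi>) = drop s \<pi>"
  using assms by (simp add: ins_def Suc_diff_le)

lemma drop_take_append_drop:
  "s \<le> i \<Longrightarrow> i \<le> length \<pi> \<Longrightarrow> drop s \<pi> = drop s (take i \<pi>) @ drop i \<pi>"
  by (metis append_take_drop_id drop_append drop_eq_Nil2 length_take min.absorb2 diff_is_0_eq drop0)

lemma take_append_drop_take:
  "i \<le> s \<Longrightarrow> take s \<pi> = take i \<pi> @ drop i (take s \<pi>)"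
  by (metis append_take_drop_id min.absorb1 take_take)

section \<open>Effect of inserting a maximum on stretches, goodness and sites\<close>

context
  fixes \<pi> :: "nat list" and x i :: nat
  assumes dist: "distinct \<pi>" and max: "\<And>y. y \<in> set \<pi> \<Longrightarrow> y < x" and i: "i \<le> length \<pi>"
begin

lemma dec_ins_left: "t \<le> i \<Longrightarrow> dec (ins i x \<pi>) s t \<longleftrightarrow> dec \<pi> s t"
  using i by (simp add: dec_def take_ins_left)

lemma dec_ins_right: "i \<le> s \<Longrightarrow> dec (ins i x \<pi>) (Suc s) (Suc t) \<longleftrightarrow> dec \<pi> s t"
  using drop_ins_right[of i s \<pi> x] i by (simp add: dec_def drop_take)

text \<open>The stretch contains the maximum, which must therefore be its first entry.\<close>

lemma dec_ins_across:
  assumes "s \<le> i" "i \<le> t"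
  shows "dec (ins i x \<pi>) s (Suc t) \<longleftrightarrow> s = i \<and> dec \<pi> i t"
proof -
  have eq: "drop s (take (Suc t) (ins i x \<pi>)) = drop s (take i \<pi>) @ x # drop i (take t \<pi>)"
    using assms i by (simp add: take_ins_right)
  have "\<forall>y\<in>set (drop s (take i \<pi>)) \<union> set (drop i (take t \<pi>)). y < x"
    using max by (meson UnE in_set_dropD in_set_takeD)
  note * = sorted_wrt_greater_insert_max[OF this]
  have "drop s (take i \<pi>) = [] \<longleftrightarrow> s = i" using assms i by auto
  then show ?thesis unfolding dec_def eq * by blast
qed

lemma good_ins_left:
  assumes "s \<le> i" "0 < i"
  shows "good (ins i x \<pi>) s \<longleftrightarrow> good \<pi> s"
proof -
  have ne: "\<pi> \<noteq> []" using assms i by auto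
  then have "hd (ins i x \<pi>) = hd \<pi>" using assms i by (simp add: ins_def)
  moreover have "hd \<pi> < x" using max ne by simp
  ultimately show ?thesis
    unfolding good_def drop_ins_left[OF assms(1) i] drop_take_append_drop[OF assms(1) i] by auto
qed

lemma good_ins_right:
  assumes "i \<le> s" "0 < i"
  shows "good (ins i x \<pi>) (Suc s) \<longleftrightarrow> good \<pi> s"
proof -
  have ne: "\<pi> \<noteq> []" using assms i by auto
  then have "hd (ins i x \<pi>) = hd \<pi>" using assms i by (simp add: ins_def)
  then show ?thesis
    unfolding good_def drop_ins_right[OF assms(1) i] by simp
qed

lemma good_ins_0: "good (ins 0 x \<pi>) (Suc s) \<longleftrightarrow> length \<pi> \<le> s"
proof -
  have "\<not> x < d" if "d \<in> set (drop s \<pi>)" for d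
    using that max by (meson in_set_dropD less_asym)
  then show ?thesis unfolding good_def ins_def
    by (cases "drop s \<pi> = []") (auto simp: neq_Nil_conv)
qed

text \<open>The maximum joins the suffix. The only danger there is an increasing triple ending in
  it; it cannot lie below an ascent of the prefix.\<close>

lemma sites_ins_left:
  assumes "s \<le> i"
  shows "s \<in> sites (ins i x \<pi>) \<longleftrightarrow> s \<in> sites \<pi> \<and> dec \<pi> s i"
proof -
  have lt: "y < x" if "y \<in> set (drop s (take i \<pi>)) \<union> set (drop i \<pi>)" for y
    using that max by (meson UnE in_set_dropD in_set_takeD)
  then have lt0: "\<forall>y\<in>set (drop s (take i \<pi>)) \<union> set (drop i \<pi>). y < x" by blast
  have xs: "\<not> x < a" if "subseq [a, b] (take s \<pi>)" for a b
    using subseq_set[OF that] max by (auto dest!: in_set_takeD dest: less_asym)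
  have "distinct (drop s (take i \<pi>))" using dist by simp
  note d = sorted_wrt_greater_iff[OF this]
  have ins3: "has123 (drop s (take i \<pi>) @ x # drop i \<pi>) \<longleftrightarrow> has123 (drop s \<pi>) \<or> \<not> dec \<pi> s i"
    unfolding has123_insert_max[OF lt0] drop_take_append_drop[OF assms i, symmetric] dec_def d by simp
  have set: "set (drop s (take i \<pi>) @ x # drop i \<pi>) = insert x (set (drop s \<pi>))"
    unfolding drop_take_append_drop[OF assms i] by auto
  have third: "(\<exists>a b d. subseq [a, b] (take s \<pi>) \<and> a < b \<and> d \<in> insert x (set (drop s \<pi>)) \<and> d < a)
     \<longleftrightarrow> (\<exists>a b d. subseq [a, b] (take s \<pi>) \<and> a < b \<and> d \<in> set (drop s \<pi>) \<and> d < a)"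
    using xs by blast
  show ?thesis
    unfolding sites_def mem_Collect_eq insertable_def take_ins_left[OF assms i] drop_ins_left[OF assms i]
      ins3 set third
    using assms i by auto
qed

text \<open>The maximum joins the prefix. It completes an increasing triple exactly when an ascent
  precedes it, and it forms an ascent with every earlier entry, so each of these entries must lie
  below the suffix.\<close>

lemma sites_ins_right:
  assumes "i \<le> s" "s \<le> length \<pi>"
  shows "Suc s \<in> sites (ins i x \<pi>) \<longleftrightarrow>
    s \<in> sites \<pi> \<and> dec \<pi> 0 i \<and> (\<forall>a\<in>set (take i \<pi>). \<forall>d\<in>set (drop s \<pi>). a < d)"
proof -
  let ?l = "take i \<pi>" and ?r = "drop i (take s \<pi>)"
  have lt: "y < x" if "y \<in> set ?l \<union> set ?r" for y
    using that max by (meson UnE in_set_dropD in_set_takeD)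
  then have lt0: "\<forall>y\<in>set ?l \<union> set ?r. y < x" by blast
  have notin: "x \<notin> set ?l" "x \<notin> set ?r" using lt by auto
  have "distinct ?l" using dist by simp
  note d = sorted_wrt_greater_iff[OF this]
  have ts: "?l @ ?r = take s \<pi>" using take_append_drop_take[OF assms(1), of \<pi>] by (rule sym)
  have ins3: "has123 (?l @ x # ?r) \<longleftrightarrow> has123 (take s \<pi>) \<or> \<not> dec \<pi> 0 i"
    unfolding has123_insert_max[OF lt0] ts dec_def drop_0 d by simp
  have disj: "set ?l \<inter> set (drop s \<pi>) = {}"
    using dist assms by (meson disjoint_iff_not_equal set_take_disj_set_drop_if_distinct)
  have rx: "\<not> d < x \<Longrightarrow> d \<notin> set (drop s \<pi>)" for d
    using max by (meson in_set_dropD)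
  have third: "(\<exists>a b d. subseq [a, b] (?l @ x # ?r) \<and> a < b \<and> d \<in> set (drop s \<pi>) \<and> d < a)
     \<longleftrightarrow> (\<exists>a b d. subseq [a, b] (take s \<pi>) \<and> a < b \<and> d \<in> set (drop s \<pi>) \<and> d < a) \<or>
         (\<exists>a\<in>set ?l. \<exists>d\<in>set (drop s \<pi>). d < a)" (is "?L \<longleftrightarrow> ?R")
  proof
    assume ?L
    then obtain a b d where abd: "subseq [a, b] (?l @ x # ?r)" "a < b" "d \<in> set (drop s \<pi>)" "d < a"
      by blast
    then have "subseq [a, b] (take s \<pi>) \<or> a \<in> set ?l"
      unfolding subseq2_insert[OF notin] ts using lt[of b] by auto
    then show ?R using abd by blast
  next
    assume ?R
    then show ?L
    proof
      assume "\<exists>a b d. subseq [a, b] (take s \<pi>) \<and> a < b \<and> d \<in> set (drop s \<pi>) \<and> d < a"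
      then show ?L unfolding subseq2_insert[OF notin] ts by blast
    next
      assume "\<exists>a\<in>set ?l. \<exists>d\<in>set (drop s \<pi>). d < a"
      then obtain a d where "a \<in> set ?l" "d \<in> set (drop s \<pi>)" "d < a" by blast
      moreover from this have "subseq [a, x] (?l @ x # ?r)" "a < x"
        using lt by (simp_all add: subseq2_insert[OF notin])
      ultimately show ?L by blast
    qed
  qed
  have cross: "(\<exists>a\<in>set ?l. \<exists>d\<in>set (drop s \<pi>). d < a) \<longleftrightarrow>
      \<not> (\<forall>a\<in>set ?l. \<forall>d\<in>set (drop s \<pi>). a < d)"
    using disj by (metis disjoint_iff less_asym nat_neq_iff)
  have "Suc s \<le> length (ins i x \<pi>) \<longleftrightarrow> s \<le> length \<pi>" by simp
  then show ?thesis
    unfolding sites_def mem_Collect_eq insertable_def take_ins_right[OF assms(1) i]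
      drop_ins_right[OF assms(1) i] ins3 third cross
    by blast
qed

end

section \<open>Permutations and their children in the generating tree\<close>

definition isperm :: "nat list \<Rightarrow> bool" where
  "isperm \<pi> \<longleftrightarrow> \<pi> \<in> permutations_of_set {1..length \<pi>}"

abbreviation child :: "nat \<Rightarrow> nat list \<Rightarrow> nat list" where
  "child i \<pi> \<equiv> ins i (Suc (length \<pi>)) \<pi>"

lemma isperm_iff: "isperm \<pi> \<longleftrightarrow> distinct \<pi> \<and> set \<pi> = {1..length \<pi>}"
  by (auto simp: isperm_def permutations_of_set_def)

lemma set_ins: "set (ins i x \<pi>) = insert x (set \<pi>)"
proof -
  have "set (ins i x \<pi>) = insert x (set (take i \<pi> @ drop i \<pi>))"
    unfolding ins_def set_append by auto
  then show ?thesis by simp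
qed

lemma isperm_distinct: "isperm \<pi> \<Longrightarrow> distinct \<pi>"
  by (simp add: isperm_iff)

lemma isperm_less: "isperm \<pi> \<Longrightarrow> y \<in> set \<pi> \<Longrightarrow> y < Suc (length \<pi>)"
  by (simp add: isperm_iff)

lemma isperm_child:
  assumes "isperm \<pi>"
  shows "isperm (child i \<pi>)"
proof -
  have s: "set (child i \<pi>) = {1..length (child i \<pi>)}"
    using assms by (auto simp: isperm_iff set_ins)
  then have "distinct (child i \<pi>)"
    by (intro card_distinct) simp
  with s show ?thesis by (simp add: isperm_iff)
qed

lemma child_dec_left:
  "isperm \<pi> \<Longrightarrow> i \<le> length \<pi> \<Longrightarrow> t \<le> i \<Longrightarrow> dec (child i \<pi>) s t \<longleftrightarrow> dec \<pi> s t"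
  by (rule dec_ins_left) (assumption | rule isperm_distinct | erule (1) isperm_less | simp)+

lemma child_dec_right:
  "isperm \<pi> \<Longrightarrow> i \<le> length \<pi> \<Longrightarrow> i \<le> s \<Longrightarrow> dec (child i \<pi>) (Suc s) (Suc t) \<longleftrightarrow> dec \<pi> s t"
  by (rule dec_ins_right) (assumption | rule isperm_distinct | erule (1) isperm_less | simp)+

lemma child_dec_across:
  "isperm \<pi> \<Longrightarrow> i \<le> length \<pi> \<Longrightarrow> s \<le> i \<Longrightarrow> i \<le> t \<Longrightarrow>
    dec (child i \<pi>) s (Suc t) \<longleftrightarrow> s = i \<and> dec \<pi> i t"
  by (rule dec_ins_across) (assumption | rule isperm_distinct | erule (1) isperm_less | simp)+

lemma child_good_left:
  "isperm \<pi> \<Longrightarrow> i \<le> length \<pi> \<Longrightarrow> s \<le> i \<Longrightarrow> 0 < i \<Longrightarrow> good (child i \<pi>) s \<longleftrightarrow> good \<pi> s"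
  by (rule good_ins_left) (assumption | rule isperm_distinct | erule (1) isperm_less | simp)+

lemma child_good_right:
  "isperm \<pi> \<Longrightarrow> i \<le> length \<pi> \<Longrightarrow> i \<le> s \<Longrightarrow> 0 < i \<Longrightarrow> good (child i \<pi>) (Suc s) \<longleftrightarrow> good \<pi> s"
  by (rule good_ins_right) (assumption | rule isperm_distinct | erule (1) isperm_less | simp)+

lemma child_good_0: "isperm \<pi> \<Longrightarrow> good (child 0 \<pi>) (Suc s) \<longleftrightarrow> length \<pi> \<le> s"
  by (rule good_ins_0[where i = 0]) (assumption | rule isperm_distinct | erule (1) isperm_less | simp)+

lemma sites_child:
  assumes p: "isperm \<pi>" and i: "i \<le> length \<pi>"
  shows "sites (child i \<pi>) = {s \<in> sites \<pi>. s \<le> i \<and> dec \<pi> s i} \<union>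
    Suc ` {s \<in> sites \<pi>. i \<le> s \<and> dec \<pi> 0 i \<and> (\<forall>a\<in>set (take i \<pi>). \<forall>d\<in>set (drop s \<pi>). a < d)}"
    (is "_ = ?L \<union> Suc ` ?R")
proof (rule set_eqI)
  fix t
  have left: "t \<in> sites (child i \<pi>) \<longleftrightarrow> t \<in> ?L" if "t \<le> i"
    using sites_ins_left[OF isperm_distinct[OF p] _ i that, OF isperm_less[OF p]] that by simp
  have right: "Suc s \<in> sites (child i \<pi>) \<longleftrightarrow> s \<in> ?R" if "i \<le> s" "s \<le> length \<pi>" for s
    using sites_ins_right[OF isperm_distinct[OF p] _ i that, OF isperm_less[OF p]] that by simp
  show "t \<in> sites (child i \<pi>) \<longleftrightarrow> t \<in> ?L \<union> Suc ` ?R"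
  proof (cases "t \<le> i")
    case True
    then have "t \<notin> Suc ` ?R" by auto
    then show ?thesis using left[OF True] by blast
  next
    case False
    then obtain s where s: "t = Suc s" "i \<le> s" by (cases t) auto
    have "t \<notin> ?L" using False by simp
    moreover have "t \<in> sites (child i \<pi>) \<longleftrightarrow> s \<in> ?R"
    proof (cases "s \<le> length \<pi>")
      case False
      then have "t \<notin> sites (child i \<pi>)" "s \<notin> sites \<pi>"
        using s sites_le_length[of t "child i \<pi>"] sites_le_length[of s \<pi>] by auto
      then show ?thesis by simp
    qed (use right s in blast)
    moreover have "t \<in> Suc ` ?R \<longleftrightarrow> s \<in> ?R" using s by (simp add: image_iff)
    ultimately show ?thesis by blast
  qed
qed

lemma sites_child_0:
  assumes "isperm \<pi>" "0 \<in> sites \<pi>"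
  shows "sites (child 0 \<pi>) = insert 0 (Suc ` sites \<pi>)"
  using sites_child[OF assms(1), of 0] assms(2) by auto

text \<open>The first entry is the maximum of the prefix, which turns the cross condition into
  \<open>good\<close>. The site \<open>i\<close> splits in two, one on each side of the new maximum;
  the right one is allowed only if \<open>i\<close> is good.\<close>

lemma sites_child_dec:
  assumes p: "isperm \<pi>" and i: "0 < i" "i \<le> length \<pi>" "dec \<pi> 0 i"
  shows "sites (child i \<pi>) = {s \<in> sites \<pi>. s \<le> i} \<union> Suc ` {s \<in> sites \<pi>. i \<le> s \<and> good \<pi> s}"
proof -
  have hd: "hd \<pi> \<in> set (take i \<pi>)"
    using i by (cases \<pi>; cases i) auto
  have le: "a \<le> hd \<pi>" if "a \<in> set (take i \<pi>)" for a
  proof -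
    have "sorted_wrt (>) (take i \<pi>)" using i by (simp add: dec_def)
    then show ?thesis using that i by (cases \<pi>; cases i) auto
  qed
  have "(\<forall>a\<in>set (take i \<pi>). \<forall>d\<in>set (drop s \<pi>). a < d) \<longleftrightarrow> good \<pi> s" for s
    unfolding good_def using hd le by (meson le_less_trans)
  moreover have "dec \<pi> s i" for s
    using dec_mono[OF i(3), of s i] i by simp
  ultimately show ?thesis using sites_child[OF p i(2)] i(3) by simp
qed

text \<open>An ascent before the new maximum yields an increasing triple in every prefix containing
  that maximum, so no site to its right survives.\<close>

lemma sites_child_asc:
  assumes "isperm \<pi>" "i \<le> length \<pi>" "\<not> dec \<pi> 0 i"
  shows "sites (child i \<pi>) = {s \<in> sites \<pi>. s \<le> i \<and> dec \<pi> s i}"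
  using sites_child[OF assms(1,2)] assms(3) by simp

section \<open>Counting avoiders by levels of the tree\<close>

text \<open>For an avoider of length n this is the number of avoiders of length n + m in which the
  entries up to n form the given permutation.\<close>

fun descendants :: "nat \<Rightarrow> nat list \<Rightarrow> nat" where
  "descendants 0 \<pi> = 1"
| "descendants (Suc m) \<pi> = (\<Sum>i\<in>sites \<pi>. descendants m (child i \<pi>))"

definition avs :: "nat \<Rightarrow> nat list set" where
  "avs n = {\<pi>. isperm \<pi> \<and> length \<pi> = n \<and> avoider \<pi>}"

lemma avoiders_eq_avs: "avoiders n {[1,2,3,4], [2,3,4,1], [4,1,2,3]} = avs n"
  unfolding avoiders_def avs_def avoids_iff_avoider isperm_def
  by (auto simp: length_finite_permutations_of_set)

lemma finite_avs: "finite (avs n)"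
  by (rule finite_subset[of _ "permutations_of_set {1..n}"]) (auto simp: avs_def isperm_def)

lemma avoider_child:
  assumes "isperm \<pi>" "i \<le> length \<pi>"
  shows "avoider (child i \<pi>) \<longleftrightarrow> avoider \<pi> \<and> i \<in> sites \<pi>"
proof -
  have "\<forall>y\<in>set (take i \<pi>) \<union> set (drop i \<pi>). y < Suc (length \<pi>)"
    using isperm_less[OF assms(1)] by (meson UnE in_set_dropD in_set_takeD)
  from avoider_insert_max[OF this] show ?thesis
    using assms(2) by (simp add: ins_def sites_def)
qed

lemma remove_max:
  assumes "isperm \<sigma>" "length \<sigma> = Suc n"
  obtains \<pi> i where "isperm \<pi>" "length \<pi> = n" "i \<le> n" "\<sigma> = child i \<pi>"
proof -
  have "Suc n \<in> set \<sigma>" using assms by (simp add: isperm_iff)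
  then obtain l r where \<sigma>: "\<sigma> = l @ Suc n # r" by (meson split_list)
  have len: "length (l @ r) = n" using \<sigma> assms by simp
  have "insert (Suc n) (set (l @ r)) = {1..Suc n}" "Suc n \<notin> set (l @ r)" "distinct (l @ r)"
    using assms unfolding isperm_iff \<sigma> by auto
  then have "set (l @ r) = {1..Suc n} - {Suc n}" by blast
  also have "\<dots> = {1..n}" by auto
  finally have "isperm (l @ r)" using \<open>distinct (l @ r)\<close> len by (simp add: isperm_iff)
  moreover have "\<sigma> = child (length l) (l @ r)" using len \<sigma> by (simp add: ins_def)
  moreover have "length l \<le> n" using len by simp
  ultimately show ?thesis using that len by blast
qed

lemma ins_inj:
  assumes "ins i x \<pi> = ins j x \<rho>" "x \<notin> set \<pi>" "x \<notin> set \<rho>" "i \<le> length \<pi>" "j \<le> length \<rho>"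
  shows "i = j \<and> \<pi> = \<rho>"
proof -
  have "x \<notin> set (take i \<pi>)" "x \<notin> set (take j \<rho>)" "x \<notin> set (drop i \<pi>)" "x \<notin> set (drop j \<rho>)"
    using assms(2,3) by (meson in_set_dropD in_set_takeD)+
  then have "take i \<pi> = take j \<rho> \<and> drop i \<pi> = drop j \<rho>"
    using assms(1) unfolding ins_def by (auto simp: append_eq_append_conv2 Cons_eq_append_conv append_eq_Cons_conv)
  then show ?thesis using assms(4,5)
    by (metis append_take_drop_id length_take min.absorb2)
qed

lemma avs_Suc_bij:
  "bij_betw (\<lambda>(\<pi>, i). child i \<pi>) (SIGMA \<pi>:avs n. sites \<pi>) (avs (Suc n))"
  unfolding bij_betw_def
proof
  show "inj_on (\<lambda>(\<pi>, i). child i \<pi>) (SIGMA \<pi>:avs n. sites \<pi>)"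
  proof (rule inj_onI, clarify)
    fix \<pi> i \<rho> j
    assume as: "\<pi> \<in> avs n" "\<rho> \<in> avs n" "i \<in> sites \<pi>" "j \<in> sites \<rho>" "child i \<pi> = child j \<rho>"
    then have "Suc n \<notin> set \<pi>" "Suc n \<notin> set \<rho>" "length \<pi> = n" "length \<rho> = n"
      by (auto simp: avs_def isperm_iff)
    then show "\<pi> = \<rho> \<and> i = j"
      using ins_inj[of i "Suc n" \<pi> j \<rho>] as sites_le_length[of i \<pi>] sites_le_length[of j \<rho>] by simp
  qed
  show "(\<lambda>(\<pi>, i). child i \<pi>) ` (SIGMA \<pi>:avs n. sites \<pi>) = avs (Suc n)"
  proof (rule set_eqI, rule iffI)
    fix \<sigma> assume "\<sigma> \<in> (\<lambda>(\<pi>, i). child i \<pi>) ` (SIGMA \<pi>:avs n. sites \<pi>)"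
    then obtain \<pi> i where "\<pi> \<in> avs n" "i \<in> sites \<pi>" "\<sigma> = child i \<pi>" by auto
    then show "\<sigma> \<in> avs (Suc n)"
      using avoider_child[of \<pi> i] isperm_child[of \<pi> i] sites_le_length[of i \<pi>] by (simp add: avs_def)
  next
    fix \<sigma> assume \<sigma>: "\<sigma> \<in> avs (Suc n)"
    then obtain \<pi> i where \<pi>: "isperm \<pi>" "length \<pi> = n" "i \<le> n" "\<sigma> = child i \<pi>"
      using remove_max[of \<sigma> n] by (auto simp: avs_def)
    then have "avoider \<pi>" "i \<in> sites \<pi>"
      using avoider_child[of \<pi> i] \<sigma> by (auto simp: avs_def)
    then show "\<sigma> \<in> (\<lambda>(\<pi>, i). child i \<pi>) ` (SIGMA \<pi>:avs n. sites \<pi>)"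
      using \<pi> by (intro image_eqI[of _ _ "(\<pi>, i)"]) (auto simp: avs_def)
  qed
qed

text \<open>The induction on \<open>m\<close> needs an arbitrary starting level: each step moves one
  level from \<open>m\<close> to \<open>n\<close> by the bijection above.\<close>

lemma card_avs_add: "card (avs (n + m)) = (\<Sum>\<pi>\<in>avs n. descendants m \<pi>)"
proof (induction m arbitrary: n)
  case (Suc m)
  have "(\<Sum>\<pi>\<in>avs n. descendants (Suc m) \<pi>) =
      (\<Sum>(\<pi>, i)\<in>(SIGMA \<pi>:avs n. sites \<pi>). descendants m (child i \<pi>))"
    by (simp add: sum.Sigma finite_avs)
  also have "\<dots> = (\<Sum>\<sigma>\<in>avs (Suc n). descendants m \<sigma>)"
    using sum.reindex_bij_betw[OF avs_Suc_bij, of "descendants m" n]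
    by (simp add: case_prod_unfold)
  also have "\<dots> = card (avs (n + Suc m))"
    using Suc[of "Suc n"] by simp
  finally show ?case by simp
qed simp

lemma avs_0: "avs 0 = {[]}"
  by (auto simp: avs_def isperm_iff avoider_def)

lemma card_avoiders:
  "card (avoiders n {[1,2,3,4], [2,3,4,1], [4,1,2,3]}) = descendants n []"
  unfolding avoiders_eq_avs using card_avs_add[of 0 n] by (simp add: avs_0)

section \<open>States of the generating tree\<close>

definition chain :: "nat list \<Rightarrow> nat set \<Rightarrow> bool" where
  "chain \<pi> S \<longleftrightarrow> (\<forall>s\<in>S. \<forall>t\<in>S. s \<le> t \<longrightarrow> dec \<pi> s t)"

text \<open>In the next three definitions \<open>S\<close> is the set of allowed sites whose prefix contains an ascent.\<close>

definition repN :: "nat list \<Rightarrow> nat set \<Rightarrow> bool" where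
  "repN \<pi> S \<longleftrightarrow> isperm \<pi> \<and> sites \<pi> = S \<and> (\<forall>s\<in>S. \<not> dec \<pi> 0 s) \<and> chain \<pi> S"

definition repW :: "nat list \<Rightarrow> nat \<Rightarrow> nat set \<Rightarrow> bool" where
  "repW \<pi> w S \<longleftrightarrow> isperm \<pi> \<and> sites \<pi> = insert w S \<and> 0 < w \<and> dec \<pi> 0 w \<and>
     (\<forall>s\<in>S. w < s \<and> \<not> dec \<pi> 0 s) \<and> chain \<pi> (insert w S)"

definition repV :: "nat list \<Rightarrow> nat \<Rightarrow> nat set \<Rightarrow> bool" where
  "repV \<pi> k S \<longleftrightarrow> isperm \<pi> \<and> sites \<pi> = {..k} \<union> S \<and> 0 < k \<and> dec \<pi> 0 k \<and>
     length \<pi> \<in> insert k S \<and> (\<forall>s\<in>S. k < s \<and> \<not> dec \<pi> 0 s) \<and> chain \<pi> S"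

section \<open>Children of nodes, sorted by the sites with decreasing prefix\<close>

lemma chain_subset: "chain \<pi> T \<Longrightarrow> S \<subseteq> T \<Longrightarrow> chain \<pi> S"
  by (auto simp: chain_def)

text \<open>Every allowed site has an ascent in its prefix, so an insertion kills all sites to its
  right, while the chain condition keeps all those to its left.\<close>

lemma repN_child:
  assumes "repN \<pi> S" "i \<in> S"
  shows "repN (child i \<pi>) {t \<in> S. t \<le> i}"
proof -
  have p: "isperm \<pi>" and i: "i \<in> sites \<pi>" and nd: "\<not> dec \<pi> 0 i" and S: "sites \<pi> = S"
    using assms by (auto simp: repN_def)
  have le: "i \<le> length \<pi>" using i by (rule sites_le_length)
  have "sites (child i \<pi>) = {t \<in> S. t \<le> i}"
    unfolding sites_child_asc[OF p le nd] S using assms by (auto simp: repN_def chain_def)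
  moreover have "chain (child i \<pi>) {t \<in> S. t \<le> i}" "\<forall>s\<in>{t \<in> S. t \<le> i}. \<not> dec (child i \<pi>) 0 s"
    using assms child_dec_left[OF p le] by (auto simp: repN_def chain_def)
  ultimately show ?thesis using isperm_child[OF p] by (simp add: repN_def)
qed

text \<open>The site \<open>w\<close> survives to the left of the new maximum, and the good sites,
  possibly including \<open>w\<close>, survive to its right. The first entry does not change because
  \<open>0 < w\<close>, so survivors on the right stay good. Stretches from \<open>w\<close> now
  start with the maximum and stay decreasing.\<close>

lemma repW_child_w:
  assumes "repW \<pi> w S"
  shows "repW (child w \<pi>) w (Suc ` {s \<in> insert w S. good \<pi> s})"
    and "good (child w \<pi>) w \<longleftrightarrow> good \<pi> w"
    and "s \<in> Suc ` {s \<in> insert w S. good \<pi> s} \<Longrightarrow> good (child w \<pi>) s"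
proof -
  let ?T = "{s \<in> insert w S. good \<pi> s}"
  have p: "isperm \<pi>" and w: "w \<in> sites \<pi>" "0 < w" "dec \<pi> 0 w" and S: "sites \<pi> = insert w S"
    and gt: "\<And>s. s \<in> S \<Longrightarrow> w < s"
    and ch: "chain \<pi> (insert w S)"
    using assms by (auto simp: repW_def)
  have le: "w \<le> length \<pi>" using w by (simp add: sites_le_length)
  have ge: "w \<le> s" if "s \<in> insert w S" for s using that gt by (auto intro: less_imp_le)
  have "sites (child w \<pi>) = insert w (Suc ` ?T)"
    unfolding sites_child_dec[OF p w(2) le w(3)] S using ge gt by (auto dest: gt)
  moreover have "dec (child w \<pi>) 0 w" using child_dec_left[OF p le] w by simp
  moreover have gt': "w < s \<and> \<not> dec (child w \<pi>) 0 s" if "s \<in> Suc ` ?T" for s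
    using that ge child_dec_across[OF p le, of 0] w by (auto simp: less_Suc_eq_le)
  moreover have "chain (child w \<pi>) (insert w (Suc ` ?T))"
    unfolding chain_def
  proof (intro ballI impI)
    fix s t assume st: "s \<in> insert w (Suc ` ?T)" "t \<in> insert w (Suc ` ?T)" "s \<le> t"
    show "dec (child w \<pi>) s t"
    proof (cases "t = w")
      case True
      then have "s = w" using st gt'[of s] by auto
      then show ?thesis using True by simp
    next
      case False
      then obtain t' where t': "t = Suc t'" "t' \<in> insert w S" using st by auto
      show ?thesis
      proof (cases "s = w")
        case True
        have "dec \<pi> w t'" using ch t' ge by (auto simp: chain_def)
        then show ?thesis using True t' child_dec_across[OF p le order_refl ge[OF t'(2)]] by simp
      next
        case False
        then obtain s' where s': "s = Suc s'" "s' \<in> insert w S" using st by auto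
        then have "dec \<pi> s' t'" using ch t' st by (auto simp: chain_def)
        then show ?thesis using s' t' child_dec_right[OF p le ge[OF s'(2)]] by simp
      qed
    qed
  qed
  ultimately show "repW (child w \<pi>) w (Suc ` ?T)"
    using isperm_child[OF p] w by (simp add: repW_def)
  show "good (child w \<pi>) w \<longleftrightarrow> good \<pi> w" using child_good_left[OF p le] w by simp
  show "good (child w \<pi>) s" if "s \<in> Suc ` ?T"
    using that child_good_right[OF p le ge] w by auto
qed

lemma repW_child_asc:
  assumes "repW \<pi> w S" "i \<in> S"
  shows "repW (child i \<pi>) w {t \<in> S. t \<le> i}"
    and "s \<le> i \<Longrightarrow> good (child i \<pi>) s \<longleftrightarrow> good \<pi> s"
    and "w \<le> i"
proof -
  have p: "isperm \<pi>" and i: "i \<in> sites \<pi>" "w < i" and nd: "\<not> dec \<pi> 0 i" and S: "sites \<pi> = insert w S"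
    using assms by (auto simp: repW_def)
  have le: "i \<le> length \<pi>" using i by (simp add: sites_le_length)
  have "sites (child i \<pi>) = insert w {t \<in> S. t \<le> i}"
    unfolding sites_child_asc[OF p le nd] S using assms i by (auto simp: repW_def chain_def)
  moreover have "chain (child i \<pi>) (insert w {t \<in> S. t \<le> i})"
    "\<forall>s\<in>{t \<in> S. t \<le> i}. \<not> dec (child i \<pi>) 0 s" "dec (child i \<pi>) 0 w"
    using assms child_dec_left[OF p le] i by (auto simp: repW_def chain_def)
  ultimately show "repW (child i \<pi>) w {t \<in> S. t \<le> i}"
    using isperm_child[OF p] assms by (simp add: repW_def)
  show "s \<le> i \<Longrightarrow> good (child i \<pi>) s \<longleftrightarrow> good \<pi> s"
    using child_good_left[OF p le] i by simp
  show "w \<le> i" using i by simp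
qed

text \<open>Such a stretch would overlap the initial run, and the two together would make the whole
  prefix before \<open>s\<close> decreasing.\<close>

lemma repV_not_dec:
  assumes "repV \<pi> k S" "i < k" "s \<in> S"
  shows "\<not> dec \<pi> i s"
proof
  assume "dec \<pi> i s"
  moreover have "dec \<pi> 0 k" "k < s" "\<not> dec \<pi> 0 s" "s \<le> length \<pi>"
    using assms sites_le_length[of s \<pi>] by (auto simp: repV_def)
  ultimately show False using dec_glue[of \<pi> 0 k i s] assms by simp
qed

text \<open>A maximum in front prolongs the initial run and harms no site, but as the new first
  entry it destroys goodness everywhere except at the end.\<close>

lemma repV_child_0:
  assumes "repV \<pi> k S"
  shows "repV (child 0 \<pi>) (Suc k) (Suc ` S)"
    and "good (child 0 \<pi>) (Suc s) \<longleftrightarrow> length \<pi> \<le> s"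
    and "dec (child 0 \<pi>) (Suc s) (Suc t) \<longleftrightarrow> dec \<pi> s t"
proof -
  have p: "isperm \<pi>" and S: "sites \<pi> = {..k} \<union> S" and gt: "\<And>s. s \<in> S \<Longrightarrow> k < s \<and> \<not> dec \<pi> 0 s"
    and ch: "chain \<pi> S" and k: "dec \<pi> 0 k" and len: "length \<pi> \<in> insert k S"
    using assms by (auto simp: repV_def)
  have 0: "dec (child 0 \<pi>) 0 (Suc t) \<longleftrightarrow> dec \<pi> 0 t" for t
    using child_dec_across[OF p, of 0 0 t] by simp
  have d: "dec (child 0 \<pi>) (Suc s) (Suc t) \<longleftrightarrow> dec \<pi> s t" for s t
    using child_dec_right[OF p, of 0 s t] by simp
  have "insert 0 (Suc ` ({..k} \<union> S)) = {..Suc k} \<union> Suc ` S"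
    unfolding atMost_Suc_eq_insert_0 image_Un by simp
  then have "sites (child 0 \<pi>) = {..Suc k} \<union> Suc ` S"
    using sites_child_0[OF p] S by simp
  then show "repV (child 0 \<pi>) (Suc k) (Suc ` S)"
    using isperm_child[OF p] 0 d gt ch k len by (auto simp: repV_def chain_def)
  show "good (child 0 \<pi>) (Suc s) \<longleftrightarrow> length \<pi> \<le> s" by (rule child_good_0[OF p])
  show "dec (child 0 \<pi>) (Suc s) (Suc t) \<longleftrightarrow> dec \<pi> s t" by (rule d)
qed

text \<open>The maximum cuts the run at \<open>i\<close>. The sites strictly between
  \<open>i\<close> and \<open>k\<close> are lost because they are not good, while \<open>k\<close>,
  if good, joins the sites whose prefix contains an ascent. In that case \<open>gk\<close> supplies
  the decreasing stretches starting at \<open>k\<close>.\<close>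

lemma repV_child_dec:
  assumes V: "repV \<pi> k S" and i: "0 < i" "i \<le> k" and gk: "good \<pi> k \<Longrightarrow> chain \<pi> (insert k S)"
  shows "repV (child i \<pi>) i (Suc ` {s \<in> insert k S. good \<pi> s})"
    and "good (child i \<pi>) i \<longleftrightarrow> good \<pi> i"
    and "s \<in> Suc ` {s \<in> insert k S. good \<pi> s} \<Longrightarrow> good (child i \<pi>) s"
    and "s \<in> insert k S \<Longrightarrow> dec (child i \<pi>) i (Suc s) \<longleftrightarrow> dec \<pi> i s"
    and "i \<le> length \<pi>"
proof -
  let ?T = "{s \<in> insert k S. good \<pi> s}"
  have p: "isperm \<pi>" and S: "sites \<pi> = {..k} \<union> S" and gt: "\<And>s. s \<in> S \<Longrightarrow> k < s"
    and ch: "chain \<pi> S" and k: "dec \<pi> 0 k" and len: "length \<pi> \<in> insert k S"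
    using V by (auto simp: repV_def)
  have kl: "k \<le> length \<pi>" using S by (simp add: sites_le_length)
  then show le: "i \<le> length \<pi>" using i by simp
  have d: "dec \<pi> 0 i" using dec_mono[OF k] i kl by simp
  have ge: "i \<le> s" if "s \<in> insert k S" for s using that gt[of s] i by auto
  have "{s \<in> {..k} \<union> S. s \<le> i} = {..i}" using i gt by auto
  moreover have "{s \<in> {..k} \<union> S. i \<le> s \<and> good \<pi> s} = ?T"
  proof (rule set_eqI)
    fix s
    show "s \<in> {s \<in> {..k} \<union> S. i \<le> s \<and> good \<pi> s} \<longleftrightarrow> s \<in> ?T"
      using not_good_dec[OF k _ kl, of s] ge[of s] by (cases "s < k") auto
  qed
  ultimately have "sites (child i \<pi>) = {..i} \<union> Suc ` ?T"
    using sites_child_dec[OF p i(1) le d] S by simp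
  moreover have "dec (child i \<pi>) 0 i" using child_dec_left[OF p le] d by simp
  moreover have "i < s \<and> \<not> dec (child i \<pi>) 0 s" if "s \<in> Suc ` ?T" for s
    using that ge child_dec_across[OF p le, of 0] i by (auto simp: less_Suc_eq_le)
  moreover have "chain (child i \<pi>) (Suc ` ?T)"
  proof -
    have "chain \<pi> ?T"
    proof (cases "good \<pi> k")
      case True
      then show ?thesis using chain_subset[OF gk[OF True], of ?T] by auto
    next
      case False
      then have "?T \<subseteq> S" by auto
      then show ?thesis using chain_subset[OF ch] by blast
    qed
    then show ?thesis using child_dec_right[OF p le] ge by (auto simp: chain_def)
  qed
  moreover have "length (child i \<pi>) \<in> Suc ` ?T" using len by simp
  ultimately show "repV (child i \<pi>) i (Suc ` ?T)"
    using isperm_child[OF p] i by (simp add: repV_def)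
  show "good (child i \<pi>) i \<longleftrightarrow> good \<pi> i" using child_good_left[OF p le] i by simp
  show "good (child i \<pi>) s" if "s \<in> Suc ` ?T"
    using that child_good_right[OF p le ge] i by auto
  show "dec (child i \<pi>) i (Suc s) \<longleftrightarrow> dec \<pi> i s" if "s \<in> insert k S"
    using child_dec_across[OF p le order_refl ge[OF that]] by simp
qed

text \<open>Sites below \<open>k\<close> die by \<open>repV_not_dec\<close>. The site
  \<open>k\<close> survives only if its stretch to \<open>i\<close> is decreasing, and this decides
  whether a site with decreasing prefix remains.\<close>

lemma repV_child_asc:
  assumes V: "repV \<pi> k S" and i: "i \<in> S"
  shows "dec \<pi> k i \<Longrightarrow> repW (child i \<pi>) k {t \<in> S. t \<le> i}"
    and "\<not> dec \<pi> k i \<Longrightarrow> repN (child i \<pi>) {t \<in> S. t \<le> i}"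
    and "s \<le> i \<Longrightarrow> good (child i \<pi>) s \<longleftrightarrow> good \<pi> s"
    and "k \<le> i"
proof -
  have p: "isperm \<pi>" and S: "sites \<pi> = {..k} \<union> S" and gt: "\<And>s. s \<in> S \<Longrightarrow> k < s"
    and nd: "\<not> dec \<pi> 0 i" and ch: "chain \<pi> S" and k: "dec \<pi> 0 k" "0 < k"
    and ndS: "\<And>s. s \<in> S \<Longrightarrow> \<not> dec \<pi> 0 s"
    using V i by (auto simp: repV_def)
  have le: "i \<le> length \<pi>" using i S by (simp add: sites_le_length)
  have lk: "t = k" if "t \<le> k" "dec \<pi> t i" for t
    using repV_not_dec[OF V _ i, of t] that by (cases "t = k") auto
  have ti: "dec \<pi> t i" if "t \<in> S" "t \<le> i" for t using ch that i by (auto simp: chain_def)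
  have ki: "k < i" using gt i by blast
  have sites: "sites (child i \<pi>) = {t \<in> {..k} \<union> S. t \<le> i \<and> dec \<pi> t i}"
    unfolding sites_child_asc[OF p le nd] S by simp
  have chain: "chain (child i \<pi>) {t \<in> S. t \<le> i}"
    "\<forall>s\<in>{t \<in> S. t \<le> i}. \<not> dec (child i \<pi>) 0 s" "dec (child i \<pi>) 0 k"
    using child_dec_left[OF p le] ch k ki ndS by (auto simp: chain_def)
  show "repW (child i \<pi>) k {t \<in> S. t \<le> i}" if "dec \<pi> k i"
  proof -
    have "sites (child i \<pi>) = insert k {t \<in> S. t \<le> i}"
      unfolding sites using lk ti ki that by auto
    moreover have "dec \<pi> k t" if "t \<le> i" for t
      using dec_mono[OF \<open>dec \<pi> k i\<close>, of k t] that le by simp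
    then have "chain (child i \<pi>) (insert k {t \<in> S. t \<le> i})"
      using chain child_dec_left[OF p le] gt by (auto simp: chain_def dest: gt)
    ultimately show ?thesis
      using isperm_child[OF p] k gt chain by (simp add: repW_def)
  qed
  show "repN (child i \<pi>) {t \<in> S. t \<le> i}" if "\<not> dec \<pi> k i"
  proof -
    have "sites (child i \<pi>) = {t \<in> S. t \<le> i}"
      unfolding sites using lk ti ki that by auto
    then show ?thesis
      using isperm_child[OF p] chain by (simp add: repN_def)
  qed
  show "s \<le> i \<Longrightarrow> good (child i \<pi>) s \<longleftrightarrow> good \<pi> s"
    using child_good_left[OF p le] ki by simp
  show "k \<le> i" using ki by simp
qed

lemma decreasing_repV:
  assumes "isperm \<pi>" "dec \<pi> 0 (length \<pi>)" "\<pi> \<noteq> []"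
  shows "repV \<pi> (length \<pi>) {}"
proof -
  have d: "sorted_wrt (>) \<pi>" using assms(2) by (simp add: dec_def)
  have no: "\<not> (a < b)" if "subseq [a, b] l" "sorted_wrt (>) l" "distinct l" for a b and l :: "nat list"
    using that sorted_wrt_greater_iff by blast
  have "insertable (take i \<pi>) (drop i \<pi>)" for i
  proof -
    have s: "sorted_wrt (>) (take i \<pi>)" "sorted_wrt (>) (drop i \<pi>)" "distinct (take i \<pi>)" "distinct (drop i \<pi>)"
      using d isperm_distinct[OF assms(1)] by (simp_all add: sorted_wrt_take sorted_wrt_drop)
    have n3: "\<not> has123 l" if "sorted_wrt (>) l" "distinct l" for l
    proof
      assume "has123 l"
      then obtain a b c where "subseq [a, b, c] l" "b < c" "a < b" unfolding has123_def by blast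
      then show False using subseq_Cons'[of a "[b, c]" l] no[of b c l] that by simp
    qed
    have "\<not> (\<exists>a b d. subseq [a, b] (take i \<pi>) \<and> a < b \<and> d \<in> set (drop i \<pi>) \<and> d < a)"
      using no[OF _ s(1,3)] by blast
    then show ?thesis unfolding insertable_def using n3[OF s(1,3)] n3[OF s(2,4)] by (intro conjI)
  qed
  then have "sites \<pi> = {..length \<pi>}" by (auto simp: sites_def)
  then show ?thesis using assms by (simp add: repV_def chain_def)
qed

section \<open>Ranks, initial segments and final segments of finite sets\<close>

text \<open>The state after an insertion at a site of \<open>S\<close> depends only on the rank of
  that site; this turns sums over sites into sums over ranks.\<close>

lemma sum_rank:
  fixes S :: "nat set" and f :: "nat \<Rightarrow> nat"
  assumes "finite S"
  shows "(\<Sum>s\<in>S. f (card {t \<in> S. t \<le> s})) = (\<Sum>j=1..card S. f j)"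
  using assms
proof (induction S rule: finite_linorder_max_induct)
  case (insert b A)
  have b: "b \<notin> A" using insert by auto
  have 1: "{t \<in> insert b A. t \<le> s} = {t \<in> A. t \<le> s}" if "s \<in> A" for s
    using insert that by force
  have 2: "{t \<in> insert b A. t \<le> b} = insert b A"
    using insert by force
  have "(\<Sum>s\<in>insert b A. f (card {t \<in> insert b A. t \<le> s})) =
      f (Suc (card A)) + (\<Sum>s\<in>A. f (card {t \<in> insert b A. t \<le> s}))"
    using insert b 2 by simp
  also have "(\<Sum>s\<in>A. f (card {t \<in> insert b A. t \<le> s})) = (\<Sum>s\<in>A. f (card {t \<in> A. t \<le> s}))"
    using 1 by simp
  finally show ?case using insert b by simp
qed simp

text \<open>If the initial segment \<open>P\<close> and the final segment \<open>G\<close> meet,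
  they cover \<open>S\<close>, so removing the complement of \<open>G\<close> from \<open>P\<close>
  leaves the intersection. If they are disjoint, truncated subtraction gives 0.\<close>

lemma card_down_up:
  fixes S :: "nat set"
  assumes "finite S"
    and down: "\<And>s t. s \<in> S \<Longrightarrow> t \<in> S \<Longrightarrow> t \<le> s \<Longrightarrow> P s \<Longrightarrow> P t"
    and up: "\<And>s t. s \<in> S \<Longrightarrow> t \<in> S \<Longrightarrow> s \<le> t \<Longrightarrow> G s \<Longrightarrow> G t"
  shows "card {s \<in> S. P s \<and> G s} = card {s \<in> S. P s} - (card S - card {s \<in> S. G s})"
proof -
  have G: "card S - card {s \<in> S. G s} = card {s \<in> S. \<not> G s}"
  proof -
    have "S = {s \<in> S. G s} \<union> {s \<in> S. \<not> G s}" by blast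
    then have "card S = card {s \<in> S. G s} + card {s \<in> S. \<not> G s}"
      using assms(1) by (metis (no_types, lifting) card_Un_disjoint disjoint_iff finite_Un mem_Collect_eq)
    then show ?thesis by simp
  qed
  show ?thesis
  proof (cases "\<exists>s\<in>S. P s \<and> G s")
    case True
    then obtain s where s: "s \<in> S" "P s" "G s" by blast
    have "P t" if "t \<in> S" "\<not> G t" for t
      using down[OF s(1) that(1) _ s(2)] up[OF s(1) that(1) _ s(3)] that(2) by (cases "t \<le> s") auto
    then have "{s \<in> S. P s \<and> G s} = {s \<in> S. P s} - {s \<in> S. \<not> G s}" "{s \<in> S. \<not> G s} \<subseteq> {s \<in> S. P s}"
      by auto
    then show ?thesis unfolding G using assms(1) by (simp add: card_Diff_subset)
  next
    case False
    then have "{s \<in> S. P s \<and> G s} = {}" "{s \<in> S. P s} \<subseteq> {s \<in> S. \<not> G s}" by auto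
    then show ?thesis unfolding G using assms(1) by (simp add: card_mono)
  qed
qed

lemma down_iff_rank:
  fixes S :: "nat set"
  assumes "finite S" "s \<in> S"
    and down: "\<And>s t. s \<in> S \<Longrightarrow> t \<in> S \<Longrightarrow> t \<le> s \<Longrightarrow> P s \<Longrightarrow> P t"
  shows "P s \<longleftrightarrow> card {t \<in> S. t \<le> s} \<le> card {t \<in> S. P t}"
proof
  assume "P s"
  then have "{t \<in> S. t \<le> s} \<subseteq> {t \<in> S. P t}" using down assms(2) by blast
  then show "card {t \<in> S. t \<le> s} \<le> card {t \<in> S. P t}" using assms(1) by (simp add: card_mono)
next
  assume le: "card {t \<in> S. t \<le> s} \<le> card {t \<in> S. P t}"
  show "P s"
  proof (rule ccontr)
    assume "\<not> P s"
    moreover have "t \<le> s" if "t \<in> S" "P t" for t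
      using down[OF that(1) assms(2) _ that(2)] \<open>\<not> P s\<close> by (cases "s \<le> t") auto
    ultimately have "{t \<in> S. P t} \<subset> {t \<in> S. t \<le> s}" using assms(2) by blast
    then have "card {t \<in> S. P t} < card {t \<in> S. t \<le> s}" using assms(1) by (simp add: psubset_card_mono)
    then show False using le by simp
  qed
qed

lemma card_Suc_image_Collect: "card {s \<in> Suc ` S. P s} = card {s \<in> S. P (Suc s)}"
proof -
  have "{s \<in> Suc ` S. P s} = Suc ` {s \<in> S. P (Suc s)}" by blast
  then show ?thesis by (simp add: card_image)
qed

text \<open>The parameters count allowed sites. \<open>StB\<close> and \<open>StE\<close>: the initial decreasing run carries
  the sites \<open>0..k\<close>, and there are \<open>q\<close> further allowed sites \<open>s\<close>, of which \<open>x\<close> have a decreasing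
  stretch from \<open>k\<close> to \<open>s\<close> and \<open>r\<close> are good; \<open>StE\<close> is the case where \<open>k\<close> itself is good, so that
  the permutation is a direct sum. \<open>StQ\<close> and \<open>StP\<close>: only one site \<open>w\<close> with decreasing prefix is
  left, bad or good respectively. \<open>StN\<close>: no such site is left. \<open>StD\<close>: the decreasing permutations.\<close>

datatype state =
    StN nat
  | StQ nat nat
  | StP nat
  | StB nat nat nat nat
  | StE nat nat
  | StD nat

text \<open>In \<open>StE\<close> the set \<open>S\<close> is nonempty, since otherwise
  \<open>k\<close> is the end of the permutation and the permutation is decreasing, which is
  \<open>StD\<close>.\<close>

fun has_state :: "state \<Rightarrow> nat list \<Rightarrow> bool" where
  "has_state (StN q) \<pi> \<longleftrightarrow> (\<exists>S. repN \<pi> S \<and> card S = q)"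
| "has_state (StQ q r) \<pi> \<longleftrightarrow>
    (\<exists>w S. repW \<pi> w S \<and> \<not> good \<pi> w \<and> card S = q \<and> card {s \<in> S. good \<pi> s} = r)"
| "has_state (StP q) \<pi> \<longleftrightarrow> (\<exists>w S. repW \<pi> w S \<and> good \<pi> w \<and> card S = q)"
| "has_state (StB k q x r) \<pi> \<longleftrightarrow>
    (\<exists>S. repV \<pi> k S \<and> \<not> good \<pi> k \<and> card S = q \<and> card {s \<in> S. dec \<pi> k s} = x \<and>
      card {s \<in> S. good \<pi> s} = r)"
| "has_state (StE k q) \<pi> \<longleftrightarrow>
    (\<exists>S. repV \<pi> k S \<and> good \<pi> k \<and> S \<noteq> {} \<and> chain \<pi> (insert k S) \<and> card S = q)"
| "has_state (StD k) \<pi> \<longleftrightarrow> isperm \<pi> \<and> length \<pi> = k \<and> dec \<pi> 0 k"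

text \<open>The \<open>q - r\<close> bad sites are the lowest ones, so \<open>j - (q - r)\<close>,
  truncated at 0, is the number of good sites among the lowest \<open>j\<close>. The parameter 1
  after an insertion in front counts the end of the permutation, the one site that is still good. In
  the children of \<open>StE k q\<close> the index \<open>Suc q\<close> arises because
  \<open>k\<close> joins the further sites.\<close>

fun tree_count :: "nat \<Rightarrow> state \<Rightarrow> nat" where
  "tree_count 0 _ = 1"
| "tree_count (Suc m) (StN q) = (\<Sum>j=1..q. tree_count m (StN j))"
| "tree_count (Suc m) (StQ q r) = tree_count m (StQ r r) + (\<Sum>j=1..q. tree_count m (StQ j (j - (q - r))))"
| "tree_count (Suc m) (StP q) = tree_count m (StP (Suc q)) + (\<Sum>j=1..q. tree_count m (StP j))"
| "tree_count (Suc m) (StB k q x r) = tree_count m (StB (Suc k) q x 1) + (\<Sum>i=1..<k. tree_count m (StB i r 0 r))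
    + tree_count m (StB k r (x - (q - r)) r)
    + (\<Sum>j=1..q. if j \<le> x then tree_count m (StQ j (j - (q - r))) else tree_count m (StN j))"
| "tree_count (Suc m) (StE k q) = tree_count m (StB (Suc k) q q 1) + (\<Sum>i=1..<k. tree_count m (StB i (Suc q) 1 (Suc q)))
    + tree_count m (StE k (Suc q)) + (\<Sum>j=1..q. tree_count m (StP j))"
| "tree_count (Suc m) (StD k) = tree_count m (StD (Suc k)) +
    (if k = 0 then 0 else (\<Sum>i=1..<k. tree_count m (StB i 1 1 1)) + tree_count m (StE k 1))"

section \<open>The recursion of each state\<close>

lemma card_good_le:
  fixes S :: "nat set"
  assumes "finite S"
  shows "card {t \<in> {t \<in> S. t \<le> i}. good \<pi> t} =
    card {t \<in> S. t \<le> i} - (card S - card {t \<in> S. good \<pi> t})"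
  using card_down_up[OF assms, of "\<lambda>t. t \<le> i" "good \<pi>"] good_mono by simp

lemma descendants_StN:
  assumes IH: "\<And>st \<pi>. has_state st \<pi> \<Longrightarrow> descendants m \<pi> = tree_count m st" and N: "repN \<pi> S"
  shows "descendants (Suc m) \<pi> = (\<Sum>j=1..card S. tree_count m (StN j))"
proof -
  have S: "sites \<pi> = S" using N by (simp add: repN_def)
  have "descendants m (child i \<pi>) = tree_count m (StN (card {t \<in> S. t \<le> i}))" if "i \<in> S" for i
    using repN_child[OF N that] by (intro IH) auto
  then have "descendants (Suc m) \<pi> = (\<Sum>i\<in>S. tree_count m (StN (card {t \<in> S. t \<le> i})))"
    by (simp add: S)
  also have "\<dots> = (\<Sum>j=1..card S. tree_count m (StN j))"
    using sum_rank[of S "\<lambda>j. tree_count m (StN j)"] S finite_sites[of \<pi>] by simp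
  finally show ?thesis .
qed

lemma repW_finite: "repW \<pi> w S \<Longrightarrow> finite S \<and> w \<notin> S"
  using finite_sites[of \<pi>] by (auto simp: repW_def)

lemma repV_finite: "repV \<pi> k S \<Longrightarrow> finite S \<and> {..k} \<inter> S = {}"
  using finite_sites[of \<pi>] by (auto simp: repV_def)

lemma repW_asc_StQ:
  assumes W: "repW \<pi> w S" and g: "\<not> good \<pi> w" and i: "i \<in> S"
  shows "has_state (StQ (card {t \<in> S. t \<le> i}) (card {t \<in> S. t \<le> i} - (card S - card {t \<in> S. good \<pi> t}))) (child i \<pi>)"
proof -
  note c = repW_child_asc[OF W i]
  have "{t \<in> {t \<in> S. t \<le> i}. good (child i \<pi>) t} = {t \<in> {t \<in> S. t \<le> i}. good \<pi> t}"
    using c(2) by blast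
  then show ?thesis
    using c(1) c(2)[OF c(3)] g card_good_le[of S i \<pi>] repW_finite[OF W] unfolding has_state.simps
    by (intro exI[of _ w] exI[of _ "{t \<in> S. t \<le> i}"]) simp
qed

lemma descendants_StQ:
  assumes IH: "\<And>st \<pi>. has_state st \<pi> \<Longrightarrow> descendants m \<pi> = tree_count m st"
    and W: "repW \<pi> w S" and g: "\<not> good \<pi> w"
    and q: "card S = q" and r: "card {s \<in> S. good \<pi> s} = r"
  shows "descendants (Suc m) \<pi> = tree_count (Suc m) (StQ q r)"
proof -
  have S: "sites \<pi> = insert w S" using W by (simp add: repW_def)
  have fin: "finite S" "w \<notin> S" using repW_finite[OF W] by auto
  have "{s \<in> insert w S. good \<pi> s} = {s \<in> S. good \<pi> s}" using g by auto
  note w = repW_child_w[OF W, unfolded this]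
  have "{s \<in> Suc ` {s \<in> S. good \<pi> s}. good (child w \<pi>) s} = Suc ` {s \<in> S. good \<pi> s}"
    using w(3) by blast
  moreover have "card (Suc ` {s \<in> S. good \<pi> s}) = r" using r by (simp add: card_image)
  ultimately have "has_state (StQ r r) (child w \<pi>)"
    using w(1) w(2) g unfolding has_state.simps
    by (intro exI[of _ w] exI[of _ "Suc ` {s \<in> S. good \<pi> s}"]) simp
  from IH[OF this] have 1: "descendants m (child w \<pi>) = tree_count m (StQ r r)" .
  have "descendants m (child i \<pi>) = tree_count m (StQ (card {t \<in> S. t \<le> i}) (card {t \<in> S. t \<le> i} - (q - r)))"
    if "i \<in> S" for i
    using IH[OF repW_asc_StQ[OF W g that]] q r by simp
  then have "(\<Sum>i\<in>S. descendants m (child i \<pi>)) = (\<Sum>j=1..q. tree_count m (StQ j (j - (q - r))))"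
    using sum_rank[OF fin(1), of "\<lambda>j. tree_count m (StQ j (j - (q - r)))"] q by simp
  then show ?thesis using 1 fin by (simp add: S)
qed

lemma descendants_StP:
  assumes IH: "\<And>st \<pi>. has_state st \<pi> \<Longrightarrow> descendants m \<pi> = tree_count m st"
    and W: "repW \<pi> w S" and g: "good \<pi> w" and q: "card S = q"
  shows "descendants (Suc m) \<pi> = tree_count (Suc m) (StP q)"
proof -
  have S: "sites \<pi> = insert w S" using W by (simp add: repW_def)
  have fin: "finite S" "w \<notin> S" using repW_finite[OF W] by auto
  have "good \<pi> s" if "s \<in> insert w S" for s
    using good_mono[OF g, of s] that W by (auto simp: repW_def less_imp_le)
  then have "{s \<in> insert w S. good \<pi> s} = insert w S" by blast
  note w = repW_child_w[OF W, unfolded this]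
  have "card (Suc ` insert w S) = Suc q" using q fin by (simp add: card_image inj_image_mem_iff)
  then have "has_state (StP (Suc q)) (child w \<pi>)"
    using w(1) w(2) g unfolding has_state.simps
    by (intro exI[of _ w] exI[of _ "Suc ` insert w S"]) (simp del: image_insert)
  from IH[OF this] have 1: "descendants m (child w \<pi>) = tree_count m (StP (Suc q))" .
  have "has_state (StP (card {t \<in> S. t \<le> i})) (child i \<pi>)" if "i \<in> S" for i
    using repW_child_asc[OF W that] g unfolding has_state.simps
    by (intro exI[of _ w] exI[of _ "{t \<in> S. t \<le> i}"]) simp
  from IH[OF this] have "(\<Sum>i\<in>S. descendants m (child i \<pi>)) = (\<Sum>j=1..q. tree_count m (StP j))"
    using sum_rank[OF fin(1), of "\<lambda>j. tree_count m (StP j)"] q by simp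
  then show ?thesis using 1 fin by (simp add: S)
qed

lemma sum_atMost_split3:
  fixes f :: "nat \<Rightarrow> nat"
  assumes "0 < k"
  shows "(\<Sum>i\<le>k. f i) = f 0 + (\<Sum>i=1..<k. f i) + f k"
proof -
  have "{..k} = insert 0 (insert k {1..<k})" using assms by auto
  then show ?thesis using assms by simp
qed

lemma descendants_repV:
  assumes V: "repV \<pi> k S"
  shows "descendants (Suc m) \<pi> = descendants m (child 0 \<pi>) + (\<Sum>i=1..<k. descendants m (child i \<pi>))
    + descendants m (child k \<pi>) + (\<Sum>i\<in>S. descendants m (child i \<pi>))"
proof -
  have S: "sites \<pi> = {..k} \<union> S" "0 < k" using V by (simp_all add: repV_def)
  have "descendants (Suc m) \<pi> =
      (\<Sum>i\<le>k. descendants m (child i \<pi>)) + (\<Sum>i\<in>S. descendants m (child i \<pi>))"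
    unfolding descendants.simps S(1) using repV_finite[OF V] by (intro sum.union_disjoint) auto
  then show ?thesis using sum_atMost_split3[OF S(2)] by simp
qed

lemma repV_near_down:
  assumes "repV \<pi> k S" "s \<in> S" "t \<le> s" "dec \<pi> k s"
  shows "dec \<pi> k t"
  using assms dec_mono[of \<pi> k s k t] sites_le_length[of s \<pi>] by (auto simp: repV_def)

lemma repV_child_0_StB:
  assumes V: "repV \<pi> k S" and ne: "k \<noteq> length \<pi>"
  shows "has_state (StB (Suc k) (card S) (card {s \<in> S. dec \<pi> k s}) 1) (child 0 \<pi>)"
proof -
  note c = repV_child_0[OF V]
  have len: "length \<pi> \<in> S" using V ne by (simp add: repV_def)
  have lt: "k < length \<pi>" using len V by (simp add: repV_def)
  \<comment> \<open>After the insertion in front only the empty suffix lies above the first entry,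
    so exactly one site is good.\<close>
  have "{s \<in> S. length \<pi> \<le> s} = {length \<pi>}"
    using len sites_le_length[of _ \<pi>] V by (auto simp: repV_def intro: le_antisym)
  then have "card {s \<in> Suc ` S. good (child 0 \<pi>) s} = 1"
    by (simp add: card_Suc_image_Collect c(2))
  moreover have "card {s \<in> Suc ` S. dec (child 0 \<pi>) (Suc k) s} = card {s \<in> S. dec \<pi> k s}"
    by (simp add: card_Suc_image_Collect c(3))
  moreover have "card (Suc ` S) = card S" by (simp add: card_image)
  ultimately show ?thesis using c(1) c(2)[of k] lt unfolding has_state.simps
    by (intro exI[of _ "Suc ` S"]) simp
qed

lemma descendants_StB:
  assumes IH: "\<And>st \<pi>. has_state st \<pi> \<Longrightarrow> descendants m \<pi> = tree_count m st"
    and V: "repV \<pi> k S" and g: "\<not> good \<pi> k"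
    and q: "card S = q" and x: "card {s \<in> S. dec \<pi> k s} = x" and r: "card {s \<in> S. good \<pi> s} = r"
  shows "descendants (Suc m) \<pi> = tree_count (Suc m) (StB k q x r)"
proof -
  have fin: "finite S" using repV_finite[OF V] by blast
  have k: "0 < k" "dec \<pi> 0 k" and kl: "k \<le> length \<pi>"
    using V sites_le_length[of k \<pi>] by (auto simp: repV_def)
  have "k \<noteq> length \<pi>" using g by auto
  from IH[OF repV_child_0_StB[OF V this]]
  have c0: "descendants m (child 0 \<pi>) = tree_count m (StB (Suc k) q x 1)" using q x by simp
  let ?T = "{s \<in> S. good \<pi> s}"
  have T: "{s \<in> insert k S. good \<pi> s} = ?T" using g by auto
  have ci: "repV (child i \<pi>) i (Suc ` ?T)" "\<not> good (child i \<pi>) i"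
    "card (Suc ` ?T) = r" "card {s \<in> Suc ` ?T. good (child i \<pi>) s} = r"
    "card {s \<in> Suc ` ?T. dec (child i \<pi>) i s} = card {s \<in> ?T. dec \<pi> i s}"
    if i: "0 < i" "i \<le> k" for i
  proof -
    note c = repV_child_dec[OF V i, unfolded T]
    show "repV (child i \<pi>) i (Suc ` ?T)" using c(1) g by blast
    have "\<not> good \<pi> i" using g not_good_dec[OF k(2) _ kl, of i] i by (cases "i = k") auto
    then show "\<not> good (child i \<pi>) i" using c(2) g by blast
    show r': "card (Suc ` ?T) = r" using r by (simp add: card_image)
    have "{s \<in> Suc ` ?T. good (child i \<pi>) s} = Suc ` ?T" using c(3) g by blast
    then show "card {s \<in> Suc ` ?T. good (child i \<pi>) s} = r" using r' by simp
    have "{s \<in> ?T. dec (child i \<pi>) i (Suc s)} = {s \<in> ?T. dec \<pi> i s}" using c(4) g by blast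
    then show "card {s \<in> Suc ` ?T. dec (child i \<pi>) i s} = card {s \<in> ?T. dec \<pi> i s}"
      by (simp only: card_Suc_image_Collect)
  qed
  have "descendants m (child i \<pi>) = tree_count m (StB i r 0 r)" if i: "i \<in> {1..<k}" for i
  proof -
    have "{s \<in> ?T. dec \<pi> i s} = {}" using repV_not_dec[OF V, of i] i by auto
    then have "card {s \<in> ?T. dec \<pi> i s} = 0" by (simp only: card.empty)
    moreover have "0 < i" "i \<le> k" using i by auto
    ultimately have "has_state (StB i r 0 r) (child i \<pi>)"
      using ci[of i] unfolding has_state.simps by (intro exI[of _ "Suc ` ?T"]) simp
    then show ?thesis by (rule IH)
  qed
  then have cm: "(\<Sum>i=1..<k. descendants m (child i \<pi>)) = (\<Sum>i=1..<k. tree_count m (StB i r 0 r))" by simp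
  \<comment> \<open>Sites near \<open>k\<close> form an initial segment and good sites a final
    segment whose complement has \<open>q - r\<close> elements.\<close>
  have "{s \<in> ?T. dec \<pi> k s} = {s \<in> S. dec \<pi> k s \<and> good \<pi> s}" by blast
  then have "card {s \<in> ?T. dec \<pi> k s} = x - (q - r)"
    using card_down_up[OF fin, of "dec \<pi> k" "good \<pi>"] repV_near_down[OF V] good_mono x q r by simp
  then have "has_state (StB k r (x - (q - r)) r) (child k \<pi>)"
    using ci[OF k(1) order_refl] unfolding has_state.simps by (intro exI[of _ "Suc ` ?T"]) simp
  from IH[OF this] have ck: "descendants m (child k \<pi>) = tree_count m (StB k r (x - (q - r)) r)" .
  let ?c = "\<lambda>i. card {t \<in> S. t \<le> i}"
  let ?f = "\<lambda>j. if j \<le> x then tree_count m (StQ j (j - (q - r))) else tree_count m (StN j)"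
  have "descendants m (child i \<pi>) = ?f (?c i)" if i: "i \<in> S" for i
  proof -
    note c = repV_child_asc[OF V i]
    \<comment> \<open>The sites near \<open>k\<close> are the \<open>x\<close> lowest, so the rank
      alone tells which kind of child arises.\<close>
    have near: "dec \<pi> k i \<longleftrightarrow> ?c i \<le> x"
      using down_iff_rank[OF fin i, of "dec \<pi> k"] repV_near_down[OF V] x by simp
    show ?thesis
    proof (cases "dec \<pi> k i")
      case True
      have "{t \<in> {t \<in> S. t \<le> i}. good (child i \<pi>) t} = {t \<in> {t \<in> S. t \<le> i}. good \<pi> t}"
        using c(3) by blast
      then have "card {t \<in> {t \<in> S. t \<le> i}. good (child i \<pi>) t} = ?c i - (q - r)"
        using card_good_le[OF fin, of i \<pi>] q r by simp
      then have "has_state (StQ (?c i) (?c i - (q - r))) (child i \<pi>)"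
        using c(1)[OF True] c(3)[OF c(4)] g unfolding has_state.simps
        by (intro exI[of _ k] exI[of _ "{t \<in> S. t \<le> i}"]) simp
      from IH[OF this] show ?thesis using near True by simp
    next
      case False
      then have "has_state (StN (?c i)) (child i \<pi>)"
        using c(2) unfolding has_state.simps by (intro exI[of _ "{t \<in> S. t \<le> i}"]) simp
      from IH[OF this] show ?thesis using near False by simp
    qed
  qed
  then have "(\<Sum>i\<in>S. descendants m (child i \<pi>)) = (\<Sum>j=1..q. ?f j)"
    using sum_rank[OF fin, of ?f] q by simp
  then show ?thesis unfolding descendants_repV[OF V] tree_count.simps c0 cm ck by simp
qed

text \<open>This serves both kinds of nodes with \<open>k\<close> good: \<open>StE\<close>, and the
  decreasing permutations, where \<open>S\<close> is empty. As \<open>k\<close> is good, so is every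
  site of \<open>S\<close>, and all of them survive.\<close>

lemma repV_good_child:
  assumes V: "repV \<pi> k S" and g: "good \<pi> k" and ch: "chain \<pi> (insert k S)"
  shows "i \<in> {1..<k} \<Longrightarrow> has_state (StB i (Suc (card S)) 1 (Suc (card S))) (child i \<pi>)"
    and "has_state (StE k (Suc (card S))) (child k \<pi>)"
proof -
  have fin: "finite S" "k \<notin> S" using repV_finite[OF V] by auto
  have k: "0 < k" "dec \<pi> 0 k" and kl: "k \<le> length \<pi>"
    using V sites_le_length[of k \<pi>] by (auto simp: repV_def)
  have "good \<pi> s" if "s \<in> insert k S" for s
    using good_mono[OF g, of s] that V by (auto simp: repV_def less_imp_le)
  then have T: "{s \<in> insert k S. good \<pi> s} = insert k S" by blast
  let ?T = "insert k S"
  have cT: "card (Suc ` ?T) = Suc (card S)" using fin by (simp add: card_image inj_image_mem_iff)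
  show "has_state (StB i (Suc (card S)) 1 (Suc (card S))) (child i \<pi>)" if "i \<in> {1..<k}"
  proof -
    have i: "0 < i" "i \<le> k" "i < k" using that by auto
    note c = repV_child_dec[OF V i(1,2) ch, unfolded T]
    have "\<not> good \<pi> i" using not_good_dec[OF k(2) i(3) kl] .
    moreover have "{s \<in> Suc ` ?T. good (child i \<pi>) s} = Suc ` ?T" using c(3) by blast
    \<comment> \<open>From \<open>i\<close> the stretch to the old site \<open>k\<close> stays
      inside the run, whereas a stretch to a site of \<open>S\<close> contains an ascent; hence the
      parameter 1.\<close>
    moreover have "{s \<in> ?T. dec (child i \<pi>) i (Suc s)} = {k}"
      using c(4) repV_not_dec[OF V i(3)] dec_mono[OF k(2), of i k] kl by auto
    then have "card {s \<in> Suc ` ?T. dec (child i \<pi>) i s} = 1"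
      unfolding card_Suc_image_Collect by simp
    ultimately show ?thesis
      using c(1,2) cT unfolding has_state.simps by (intro exI[of _ "Suc ` ?T"]) simp
  qed
  note c = repV_child_dec[OF V k(1) order_refl ch, unfolded T]
  have "chain (child k \<pi>) (insert k (Suc ` ?T))"
    unfolding chain_def
  proof (intro ballI impI)
    fix s t assume st: "s \<in> insert k (Suc ` ?T)" "t \<in> insert k (Suc ` ?T)" "s \<le> t"
    have ch': "chain (child k \<pi>) (Suc ` ?T)" using c(1) unfolding repV_def by blast
    have gt: "k < u" if "u \<in> Suc ` ?T" for u using c(1) that unfolding repV_def by blast
    show "dec (child k \<pi>) s t"
    proof (cases "s = k")
      case True
      show ?thesis
      proof (cases "t = k")
        case False
        then obtain t' where t': "t = Suc t'" "t' \<in> ?T" using st by blast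
        have "k \<le> t'" using t' V by (auto simp: repV_def less_imp_le)
        then have "dec \<pi> k t'" using ch t'(2) by (auto simp: chain_def)
        then show ?thesis using c(4)[OF t'(2)] True t' by simp
      qed (use True in simp)
    next
      case False
      then have s: "s \<in> Suc ` ?T" using st by blast
      then have "t \<in> Suc ` ?T" using st gt[of s] by auto
      then show ?thesis using ch' s st by (auto simp: chain_def)
    qed
  qed
  then show "has_state (StE k (Suc (card S))) (child k \<pi>)"
    using c(1,2) g cT unfolding has_state.simps by (intro exI[of _ "Suc ` ?T"]) simp
qed

lemma descendants_StE:
  assumes IH: "\<And>st \<pi>. has_state st \<pi> \<Longrightarrow> descendants m \<pi> = tree_count m st"
    and V: "repV \<pi> k S" and g: "good \<pi> k" and ch: "chain \<pi> (insert k S)"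
    and ne: "S \<noteq> {}" and q: "card S = q"
  shows "descendants (Suc m) \<pi> = tree_count (Suc m) (StE k q)"
proof -
  have fin: "finite S" using repV_finite[OF V] by blast
  obtain s where "s \<in> S" using ne by blast
  then have "k < s" "s \<le> length \<pi>" using V sites_le_length[of s \<pi>] by (auto simp: repV_def)
  then have kl: "k \<noteq> length \<pi>" by simp
  have near: "dec \<pi> k s" if "s \<in> S" for s
    using ch V that by (auto simp: chain_def repV_def less_imp_le)
  then have "{s \<in> S. dec \<pi> k s} = S" by blast
  then have c0: "descendants m (child 0 \<pi>) = tree_count m (StB (Suc k) q q 1)"
    using IH[OF repV_child_0_StB[OF V kl]] q by simp
  have cm: "(\<Sum>i=1..<k. descendants m (child i \<pi>)) = (\<Sum>i=1..<k. tree_count m (StB i (Suc q) 1 (Suc q)))"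
    using IH[OF repV_good_child(1)[OF V g ch]] q by (intro sum.cong) auto
  have ck: "descendants m (child k \<pi>) = tree_count m (StE k (Suc q))"
    using IH[OF repV_good_child(2)[OF V g ch]] q by simp
  have "descendants m (child i \<pi>) = tree_count m (StP (card {t \<in> S. t \<le> i}))" if "i \<in> S" for i
  proof -
    note c = repV_child_asc[OF V that]
    have "has_state (StP (card {t \<in> S. t \<le> i})) (child i \<pi>)"
      using c(1)[OF near[OF that]] c(3)[OF c(4)] g unfolding has_state.simps
      by (intro exI[of _ k] exI[of _ "{t \<in> S. t \<le> i}"]) simp
    then show ?thesis by (rule IH)
  qed
  then have "(\<Sum>i\<in>S. descendants m (child i \<pi>)) = (\<Sum>j=1..q. tree_count m (StP j))"
    using sum_rank[OF fin, of "\<lambda>j. tree_count m (StP j)"] q by simp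
  then show ?thesis unfolding descendants_repV[OF V] tree_count.simps c0 cm ck by simp
qed

lemma descendants_StD:
  assumes IH: "\<And>st \<pi>. has_state st \<pi> \<Longrightarrow> descendants m \<pi> = tree_count m st"
    and p: "isperm \<pi>" and l: "length \<pi> = k" and d: "dec \<pi> 0 k"
  shows "descendants (Suc m) \<pi> = tree_count (Suc m) (StD k)"
proof -
  have "dec (child 0 \<pi>) 0 (Suc k)"
    using child_dec_across[OF p, of 0 0 k] d by simp
  then have "has_state (StD (Suc k)) (child 0 \<pi>)"
    using isperm_child[OF p] l by simp
  from IH[OF this] have c0: "descendants m (child 0 \<pi>) = tree_count m (StD (Suc k))" .
  show ?thesis
  \<comment> \<open>For the empty permutation the sites 0 and \<open>k\<close> coincide, and
    \<open>repV\<close> requires a nonempty run.\<close>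
  proof (cases "k = 0")
    case True
    then have "sites \<pi> = {0}" using l by (auto simp: sites_def insertable_def has123_def)
    then show ?thesis using c0 True by simp
  next
    case False
    then have V: "repV \<pi> k {}" using decreasing_repV[OF p] d l by auto
    have g: "good \<pi> k" and ch: "chain \<pi> {k}" using l by (auto simp: chain_def good_def)
    have cm: "(\<Sum>i=1..<k. descendants m (child i \<pi>)) = (\<Sum>i=1..<k. tree_count m (StB i 1 1 1))"
      using IH[OF repV_good_child(1)[OF V g ch]] by (intro sum.cong) auto
    have ck: "descendants m (child k \<pi>) = tree_count m (StE k 1)"
      using IH[OF repV_good_child(2)[OF V g ch]] by simp
    show ?thesis unfolding descendants_repV[OF V] tree_count.simps c0 cm ck using False by simp
  qed
qed

lemma descendants_eq_tree_count: "has_state st \<pi> \<Longrightarrow> descendants m \<pi> = tree_count m st"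
proof (induction m arbitrary: st \<pi>)
  case (Suc m)
  note IH = Suc.IH
  show ?case
  proof (cases st)
    case (StN q)
    then show ?thesis using Suc.prems descendants_StN[OF IH] by auto
  next
    case (StQ q r)
    then show ?thesis using Suc.prems descendants_StQ[OF IH] unfolding StQ has_state.simps by blast
  next
    case (StP q)
    then show ?thesis using Suc.prems descendants_StP[OF IH] unfolding StP has_state.simps by blast
  next
    case (StB k q x r)
    then show ?thesis using Suc.prems descendants_StB[OF IH] unfolding StB has_state.simps by blast
  next
    case (StE k q)
    then show ?thesis using Suc.prems descendants_StE[OF IH] unfolding StE has_state.simps by blast
  next
    case (StD k)
    then show ?thesis using Suc.prems descendants_StD[OF IH] unfolding StD has_state.simps by blast
  qed
qed simp

lemma card_avoiders_tree_count:
  "card (avoiders n {[1,2,3,4], [2,3,4,1], [4,1,2,3]}) = tree_count n (StD 0)"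
proof -
  have "has_state (StD 0) []" by (simp add: isperm_iff)
  then show ?thesis unfolding card_avoiders by (rule descendants_eq_tree_count)
qed

section \<open>Generating functions of the states\<close>

definition gf :: "state \<Rightarrow> real fps" where
  "gf st = Abs_fps (\<lambda>m. real (tree_count m st))"

lemma gf_nth [simp]: "fps_nth (gf st) m = real (tree_count m st)"
  by (simp add: gf_def)

lemma fps_eq_1_plus_X_mult:
  fixes f g :: "real fps"
  assumes "fps_nth f 0 = 1" "\<And>m. fps_nth f (Suc m) = fps_nth g m"
  shows "f = 1 + fps_X * g"
proof (rule fps_ext)
  fix n show "fps_nth f n = fps_nth (1 + fps_X * g) n"
    using assms by (cases n) simp_all
qed

lemma gf_StN: "gf (StN q) = 1 + fps_X * (\<Sum>j=1..q. gf (StN j))"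
  by (rule fps_eq_1_plus_X_mult) (simp_all add: fps_sum_nth)

lemma gf_StQ: "gf (StQ q r) = 1 + fps_X * (gf (StQ r r) + (\<Sum>j=1..q. gf (StQ j (j - (q - r)))))"
  by (rule fps_eq_1_plus_X_mult) (simp_all add: fps_sum_nth)

lemma gf_StP: "gf (StP q) = 1 + fps_X * (gf (StP (Suc q)) + (\<Sum>j=1..q. gf (StP j)))"
  by (rule fps_eq_1_plus_X_mult) (simp_all add: fps_sum_nth)

lemma gf_StB: "gf (StB k q x r) = 1 + fps_X * (gf (StB (Suc k) q x 1) + (\<Sum>i=1..<k. gf (StB i r 0 r))
    + gf (StB k r (x - (q - r)) r)
    + (\<Sum>j=1..q. if j \<le> x then gf (StQ j (j - (q - r))) else gf (StN j)))"
  by (rule fps_eq_1_plus_X_mult)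
    (simp_all add: fps_sum_nth if_distrib[of real] if_distrib[of "\<lambda>f. fps_nth f _"] cong: if_cong)

lemma gf_StE: "gf (StE k q) = 1 + fps_X * (gf (StB (Suc k) q q 1)
    + (\<Sum>i=1..<k. gf (StB i (Suc q) 1 (Suc q))) + gf (StE k (Suc q)) + (\<Sum>j=1..q. gf (StP j)))"
  by (rule fps_eq_1_plus_X_mult) (simp_all add: fps_sum_nth)

lemma gf_StD_0: "gf (StD 0) = 1 + fps_X * gf (StD 1)"
  by (rule fps_eq_1_plus_X_mult) simp_all

lemma gf_StD: "0 < k \<Longrightarrow> gf (StD k) = 1 + fps_X * (gf (StD (Suc k))
    + (\<Sum>i=1..<k. gf (StB i 1 1 1)) + gf (StE k 1))"
  by (rule fps_eq_1_plus_X_mult) (simp_all add: fps_sum_nth)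

text \<open>Coefficient n + 1 depends only on coefficients n of the other series. The induction is
  on n, so the indices may climb forever, as in \<open>J k = {Suc k}\<close>.\<close>

lemma fps_fixpoint_unique:
  fixes f h a :: "nat \<Rightarrow> real fps"
  assumes J: "\<And>k. k \<in> I \<Longrightarrow> J k \<subseteq> I"
    and f: "\<And>k. k \<in> I \<Longrightarrow> f k = a k + fps_X * (\<Sum>j\<in>J k. f j)"
    and h: "\<And>k. k \<in> I \<Longrightarrow> h k = a k + fps_X * (\<Sum>j\<in>J k. h j)"
    and k: "k \<in> I"
  shows "f k = h k"
proof -
  have "\<forall>k\<in>I. fps_nth (f k) n = fps_nth (h k) n" for n
  proof (induction n)
    case 0
    show ?case
    proof
      fix k assume "k \<in> I"
      then show "fps_nth (f k) 0 = fps_nth (h k) 0" by (subst f, simp, subst h, simp_all)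
    qed
  next
    case (Suc n)
    show ?case
    proof
      fix k assume k: "k \<in> I"
      have "(\<Sum>j\<in>J k. fps_nth (f j) n) = (\<Sum>j\<in>J k. fps_nth (h j) n)"
        using Suc J[OF k] by (intro sum.cong) auto
      then show "fps_nth (f k) (Suc n) = fps_nth (h k) (Suc n)"
        by (subst f[OF k], subst h[OF k]) (simp add: fps_sum_nth)
    qed
  qed
  then show ?thesis using k by (simp add: fps_eq_iff)
qed

section \<open>The three basic series and their telescoping sums\<close>

definition U :: "real fps" where "U = inverse (1 - fps_X)"
definition V :: "real fps" where "V = inverse (1 - 2 * fps_X)"
abbreviation X :: "real fps" where "X \<equiv> fps_X"
abbreviation C :: "real fps" where "C \<equiv> catalan_gf"

lemma XU: "X * U = U - 1"
proof -
  have "(1 - X) * U = 1" unfolding U_def by (rule inverse_mult_eq_1') simp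
  then show ?thesis by (simp add: algebra_simps)
qed

lemma XV: "2 * X * V = V - 1"
proof -
  have "(1 - 2 * X) * V = 1" unfolding V_def by (rule inverse_mult_eq_1') simp
  then show ?thesis by (simp add: algebra_simps)
qed

lemma XC: "X * C^2 = C - 1"
proof -
  have "(1 - 2 * X * C)^2 = 1 - 4 * X"
    using catalan_gf_exact fps_sqrt_catalan by simp
  then have "4 * X * (X * C^2) = 4 * X * (C - 1)"
    by algebra
  then show ?thesis by simp
qed

lemma solve_U:
  assumes "(1 - X) * f = g"
  shows "f = U * g"
proof -
  have "U * ((1 - X) * f) = (U - X * U) * f" by (simp add: algebra_simps)
  then show ?thesis using XU assms by simp
qed

lemma solve_V:
  assumes "(1 - 2 * X) * f = g"
  shows "f = V * g"
proof -
  have "V * ((1 - 2 * X) * f) = (V - 2 * X * V) * f" by (simp add: algebra_simps)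
  then show ?thesis using XV assms by simp
qed

text \<open>By \<open>XU\<close> the summands telescope:
  \<open>X * U^j = U^j - U^(j - 1)\<close>.\<close>

lemma sum_U: "X * (\<Sum>j=1..q. U^j) = U^q - 1"
proof (induction q)
  case (Suc q)
  have "X * (\<Sum>j=1..Suc q. U^j) = U^q - 1 + X * U * U^q"
    using Suc by (simp add: distrib_left algebra_simps)
  then show ?case using XU by (simp add: algebra_simps)
qed simp

text \<open>By \<open>XC\<close> the summands telescope:
  \<open>X * C^(i + 1) = C^i - C^(i - 1)\<close>.\<close>

lemma sum_C: "X * (\<Sum>i=1..k. C^(i + 1)) = C^k - 1"
proof (induction k)
  case (Suc k)
  have "X * (\<Sum>j=1..Suc k. C^(j + 1)) = C^k - 1 + X * C^2 * C^k"
    using Suc by (simp add: distrib_left algebra_simps power2_eq_square)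
  then show ?case using XC by (simp add: algebra_simps)
qed simp

section \<open>Closed forms when at most one site has a decreasing prefix\<close>

lemma gf_StN_eq: "gf (StN q) = U^q"
proof (rule fps_fixpoint_unique[where f = "\<lambda>q. gf (StN q)" and h = "\<lambda>q. U^q" and I = UNIV and
      J = "\<lambda>q. {1..q}" and a = "\<lambda>_. 1"])
  show "U^k = 1 + X * (\<Sum>j=1..k. U^j)" for k unfolding sum_U by simp
qed (rule gf_StN | simp)+

lemma gf_StP_eq: "gf (StP q) = C^(q + 1)"
proof (rule fps_fixpoint_unique[where f = "\<lambda>q. gf (StP q)" and h = "\<lambda>q. C^(q + 1)" and I = UNIV and
      J = "\<lambda>q. {1..Suc q}" and a = "\<lambda>_. 1"])
  show "C^(k + 1) = 1 + X * (\<Sum>j=1..Suc k. C^(j + 1))" for k unfolding sum_C by simp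
  show "gf (StP k) = 1 + X * (\<Sum>j=1..Suc k. gf (StP j))" for k
    by (subst gf_StP) (simp add: add.commute)
qed simp_all

lemma sum_U_shift: "X * (\<Sum>j=1..q. U^(j + 1)) = U^(q + 1) - U"
proof -
  have "X * (\<Sum>j=1..q. U^(j + 1)) = U * (X * (\<Sum>j=1..q. U^j))"
    by (simp add: sum_distrib_left algebra_simps)
  then show ?thesis unfolding sum_U by (simp add: algebra_simps)
qed

lemma gf_StQ_0_0: "gf (StQ 0 0) = U"
proof -
  have "(1 - X) * gf (StQ 0 0) = 1" using gf_StQ[of 0 0] by (simp add: algebra_simps)
  from solve_U[OF this] show ?thesis by simp
qed

text \<open>Without good sites, insertion at \<open>w\<close> leads to \<open>StQ 0 0\<close>, so
  the constant source is \<open>1 + X * U = U\<close>.\<close>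

lemma gf_StQ_0_eq: "gf (StQ q 0) = U^(q + 1)"
proof (rule fps_fixpoint_unique[where f = "\<lambda>q. gf (StQ q 0)" and h = "\<lambda>q. U^(q + 1)" and I = UNIV and
      J = "\<lambda>q. {1..q}" and a = "\<lambda>_. U"])
  show "gf (StQ k 0) = U + X * (\<Sum>j=1..k. gf (StQ j 0))" for k
  proof -
    have "gf (StQ k 0) = 1 + X * (U + (\<Sum>j=1..k. gf (StQ j (j - k))))"
      using gf_StQ[of k 0] by (simp add: gf_StQ_0_0)
    also have "(\<Sum>j=1..k. gf (StQ j (j - k))) = (\<Sum>j=1..k. gf (StQ j 0))"
      by (intro sum.cong) auto
    finally show ?thesis using XU by (simp add: algebra_simps)
  qed
  show "U^(k + 1) = U + X * (\<Sum>j=1..k. U^(j + 1))" for k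
    unfolding sum_U_shift by simp
qed simp_all

lemma gf_StQ_1_1: "gf (StQ 1 1) = V"
proof -
  have "(1 - 2 * X) * gf (StQ 1 1) = 1" using gf_StQ[of 1 1] by (simp add: algebra_simps)
  from solve_V[OF this] show ?thesis by simp
qed

text \<open>Only the highest further site is good. Insertion there reproduces the state, which
  yields the factor \<open>1 - X\<close>; insertion at a lower further site leaves no good
  site.\<close>

lemma gf_StQ_Suc_1: "gf (StQ (Suc q) 1) = U^(q + 2) + X^2 * U^2 * V"
proof -
  have "gf (StQ (Suc q) 1) = 1 + X * (V + (\<Sum>j=1..Suc q. gf (StQ j (j - q))))"
    using gf_StQ[of "Suc q" 1] gf_StQ_1_1 by simp
  also have "(\<Sum>j=1..Suc q. gf (StQ j (j - q))) = (\<Sum>j=1..q. U^(j + 1)) + gf (StQ (Suc q) 1)"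
    by (simp add: gf_StQ_0_eq)
  finally have "(1 - X) * gf (StQ (Suc q) 1) = 1 + X * V + X * (\<Sum>j=1..q. U^(j + 1))"
    by (simp add: algebra_simps)
  from solve_U[OF this] have *: "gf (StQ (Suc q) 1) = U * (1 + X * V + U^(q + 1) - U)"
    unfolding sum_U_shift by (simp add: algebra_simps)
  have "U * (1 + X * V - U) = X^2 * U^2 * V" using XU XV by algebra
  then show ?thesis unfolding * by (simp add: algebra_simps power_add power2_eq_square)
qed

section \<open>Closed forms for the reachable shapes of \<open>StB\<close>\<close>

lemma sum_C_less: "X * (\<Sum>i=1..<Suc k. U * C^(i + 1)) = U * (C^k - 1)"
proof -
  have "X * (\<Sum>i=1..<Suc k. U * C^(i + 1)) = U * (X * (\<Sum>i=1..k. C^(i + 1)))"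
    unfolding atLeastLessThanSuc_atLeastAtMost by (simp add: sum_distrib_left algebra_simps)
  then show ?thesis unfolding sum_C .
qed

text \<open>The one further site contributes \<open>gf (StN 1) = U\<close>, and
  \<open>1 + X * U = U\<close> becomes the source. The other children have run lengths 1 to
  \<open>k + 1\<close>, which is the Catalan rule scaled by \<open>U\<close>.\<close>

lemma gf_StB_1_0_1:
  assumes "0 < k"
  shows "gf (StB k 1 0 1) = U * C^(k + 1)"
proof (rule fps_fixpoint_unique[where f = "\<lambda>k. gf (StB k 1 0 1)" and h = "\<lambda>k. U * C^(k + 1)" and
      I = "{0<..}" and J = "\<lambda>k. {1..Suc k}" and a = "\<lambda>_. U"])
  show "gf (StB k 1 0 1) = U + X * (\<Sum>j=1..Suc k. gf (StB j 1 0 1))" if "k \<in> {0<..}" for k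
  proof -
    have "(\<Sum>i=1..<k. gf (StB i 1 0 1)) + gf (StB k 1 0 1) = (\<Sum>i=1..k. gf (StB i 1 0 1))"
      using that by (cases k) (simp_all add: atLeastLessThanSuc_atLeastAtMost)
    moreover have "gf (StB k 1 0 1) = 1 + X * (gf (StB (Suc k) 1 0 1) + ((\<Sum>i=1..<k. gf (StB i 1 0 1))
        + gf (StB k 1 0 1)) + U)"
      using gf_StB[of k 1 0 1] by (simp add: gf_StN_eq add.assoc)
    ultimately have "gf (StB k 1 0 1) = 1 + X * (gf (StB (Suc k) 1 0 1) + (\<Sum>i=1..k. gf (StB i 1 0 1)) + U)"
      by simp
    then show ?thesis using XU by (simp add: algebra_simps)
  qed
  show "U * C^(k + 1) = U + X * (\<Sum>j=1..Suc k. U * C^(j + 1))" for k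
    using sum_C_less[of "Suc k"] unfolding atLeastLessThanSuc_atLeastAtMost by (simp add: algebra_simps)
qed (use assms in auto)

lemma sum_gf_StB_1_0_1: "X * (\<Sum>i=1..<Suc k. gf (StB i 1 0 1)) = U * (C^k - 1)"
proof -
  have "(\<Sum>i=1..<Suc k. gf (StB i 1 0 1)) = (\<Sum>i=1..<Suc k. U * C^(i + 1))"
    by (intro sum.cong) (auto simp: gf_StB_1_0_1[simplified])
  then show ?thesis using sum_C_less[of k] by simp
qed

lemma sum_gf_StB_1_0_1':
  assumes "0 < k"
  shows "X * (\<Sum>i=1..<k. gf (StB i 1 0 1)) = U * (C^(k - 1) - 1)"
proof -
  obtain m where m: "k = Suc m" using assms by (cases k) auto
  show ?thesis using sum_gf_StB_1_0_1[of m] unfolding m diff_Suc_1 .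
qed

lemma sum_U_C:
  "X * (\<Sum>j=1..k. A * U^j + U * C^(j + 1)) = A * (U^k - 1) + U * (C^k - 1)"
proof -
  have "(\<Sum>j=1..k. A * U^j + U * C^(j + 1)) = A * (\<Sum>j=1..k. U^j) + U * (\<Sum>j=1..k. C^(j + 1))"
    by (simp only: sum.distrib sum_distrib_left)
  then show ?thesis by (simp only: distrib_left mult.left_commute[of X] sum_U sum_C)
qed

lemma sum_StN_eq: "1 + X * (\<Sum>j=1..q. gf (StN j)) = U^q"
  unfolding gf_StN_eq sum_U by simp

lemma gf_StB_q_0_1:
  assumes "0 < k" "0 < q"
  shows "gf (StB k q 0 1) = U^(q + 1) - U^2 + U * C^(k + 1)"
proof (rule fps_fixpoint_unique[where f = "\<lambda>k. gf (StB k q 0 1)" and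
      h = "\<lambda>k. U^(q + 1) - U^2 + U * C^(k + 1)" and
      I = "{0<..}" and J = "\<lambda>k. {Suc k}" and a = "\<lambda>k. U^q + U * (C^k - 1)"])
  show "gf (StB k q 0 1) = U^q + U * (C^k - 1) + X * (\<Sum>j\<in>{Suc k}. gf (StB j q 0 1))"
    if "k \<in> {0<..}" for k
  proof -
    have "(\<Sum>i=1..<k. gf (StB i 1 0 1)) + gf (StB k 1 0 1) = (\<Sum>i=1..<Suc k. gf (StB i 1 0 1))"
      using that by simp
    moreover have "gf (StB k q 0 1) = (1 + X * (\<Sum>j=1..q. gf (StN j))) + X * gf (StB (Suc k) q 0 1)
        + X * ((\<Sum>i=1..<k. gf (StB i 1 0 1)) + gf (StB k 1 0 1))"
      by (subst gf_StB) (simp add: algebra_simps)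
    ultimately show ?thesis unfolding sum_StN_eq using sum_gf_StB_1_0_1[of k] by simp
  qed
  show "U^(q + 1) - U^2 + U * C^(k + 1) = U^q + U * (C^k - 1) +
      X * (\<Sum>j\<in>{Suc k}. U^(q + 1) - U^2 + U * C^(j + 1))" for k
  proof -
    \<comment> \<open>The letters \<open>P\<close> and \<open>p\<close> stand for \<open>U^q\<close>
      and \<open>C^k\<close>: with the symbolic exponents hidden, a polynomial identity modulo
      \<open>XU\<close> and \<open>XC\<close> remains.\<close>
    have "U * P - U^2 + U * (C * p) = P + U * (p - 1) + X * (U * P - U^2 + U * (C * (C * p)))" for P p
      using XU XC by algebra
    from this[of "U^q" "C^k"] show ?thesis by simp
  qed
qed (use assms in auto)

lemma gf_StB_q_0_q:
  assumes "0 < k" "0 < q"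
  shows "gf (StB k q 0 q) = (U^(q + 1) - U^2) * U^k + U * C^(k + 1)"
proof (rule fps_fixpoint_unique[where f = "\<lambda>k. gf (StB k q 0 q)" and
      h = "\<lambda>k. (U^(q + 1) - U^2) * U^k + U * C^(k + 1)" and
      I = "{0<..}" and J = "\<lambda>k. {1..k}" and a = "\<lambda>k. U^q + X * (U^(q + 1) - U^2 + U * C^(k + 2))"])
  show "gf (StB k q 0 q) = U^q + X * (U^(q + 1) - U^2 + U * C^(k + 2)) + X * (\<Sum>j\<in>{1..k}. gf (StB j q 0 q))"
    if "k \<in> {0<..}" for k
  proof -
    have "(\<Sum>i=1..<k. gf (StB i q 0 q)) + gf (StB k q 0 q) = (\<Sum>i=1..k. gf (StB i q 0 q))"
      using that by (cases k) (simp_all add: atLeastLessThanSuc_atLeastAtMost)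
    moreover have "gf (StB k q 0 q) = (1 + X * (\<Sum>j=1..q. gf (StN j))) + X * gf (StB (Suc k) q 0 1)
        + X * ((\<Sum>i=1..<k. gf (StB i q 0 q)) + gf (StB k q 0 q))"
      by (subst gf_StB) (simp add: algebra_simps)
    ultimately show ?thesis unfolding sum_StN_eq using gf_StB_q_0_1[of "Suc k" q] assms by simp
  qed
  show "(U^(q + 1) - U^2) * U^k + U * C^(k + 1) = U^q + X * (U^(q + 1) - U^2 + U * C^(k + 2)) +
      X * (\<Sum>j\<in>{1..k}. (U^(q + 1) - U^2) * U^j + U * C^(j + 1))" for k
  proof -
    have "(U * P - U^2) * R + U * (C * p) = P + X * (U * P - U^2 + U * (C * (C * p))) +
        ((U * P - U^2) * (R - 1) + U * (p - 1))" for P p R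
      using XU XC by algebra
    from this[of "U^q" "U^k" "C^k"] show ?thesis unfolding sum_U_C by simp
  qed
qed (use assms in auto)

text \<open>For \<open>x = 1\<close> only the lowest further site is near the run, so the sum
  differs in one term from the sum for \<open>StN\<close>.\<close>

lemma sum_if_le_1:
  fixes f g :: "nat \<Rightarrow> real fps"
  assumes "0 < q"
  shows "(\<Sum>j=1..q. if j \<le> 1 then f j else g j) = f 1 - g 1 + (\<Sum>j=1..q. g j)"
proof -
  have "(\<Sum>j=1..q. if j \<le> 1 then f j else g j) = f 1 + (\<Sum>j=2..q. if j \<le> 1 then f j else g j)"
    using assms by (subst sum.atLeast_Suc_atMost) (simp_all add: numeral_2_eq_2)
  also have "(\<Sum>j=2..q. if j \<le> 1 then f j else g j) = (\<Sum>j=2..q. g j)"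
    by (intro sum.cong) auto
  also have "(\<Sum>j=1..q. g j) = g 1 + (\<Sum>j=2..q. g j)"
    using assms by (subst sum.atLeast_Suc_atMost) (simp_all add: numeral_2_eq_2)
  ultimately show ?thesis by simp
qed

text \<open>For \<open>q > 1\<close> the near site is the lowest and the good site the highest, so
  they differ and insertion at \<open>k\<close> leads to \<open>StB k 1 0 1\<close>. For
  \<open>q = 1\<close> they coincide, which is the next lemma.\<close>

lemma gf_StB_q_1_1:
  assumes "0 < k" "1 < q"
  shows "gf (StB k q 1 1) = U^(q + 1) - U^2 + X^2 * U^3 + U * C^(k + 1)"
proof (rule fps_fixpoint_unique[where f = "\<lambda>k. gf (StB k q 1 1)" and
      h = "\<lambda>k. U^(q + 1) - U^2 + X^2 * U^3 + U * C^(k + 1)" and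
      I = "{0<..}" and J = "\<lambda>k. {Suc k}" and a = "\<lambda>k. U^q + X * (U^2 - U) + U * (C^k - 1)"])
  show "gf (StB k q 1 1) = U^q + X * (U^2 - U) + U * (C^k - 1) + X * (\<Sum>j\<in>{Suc k}. gf (StB j q 1 1))"
    if "k \<in> {0<..}" for k
  proof -
    have *: "(\<Sum>j=1..q. if j \<le> 1 then gf (StQ j (j - (q - 1))) else gf (StN j)) =
        U^2 - U + (\<Sum>j=1..q. gf (StN j))"
    proof -
      have "1 - (q - 1) = 0" using assms by simp
      then show ?thesis
        using sum_if_le_1[of q "\<lambda>j. gf (StQ j (j - (q - 1)))" "\<lambda>j. gf (StN j)"] assms
        by (simp add: gf_StQ_0_eq gf_StN_eq power2_eq_square)
    qed
    have **: "1 - (q - 1) = 0" using assms by simp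
    have "(\<Sum>i=1..<k. gf (StB i 1 0 1)) + gf (StB k 1 0 1) = (\<Sum>i=1..<Suc k. gf (StB i 1 0 1))"
      using that by simp
    moreover have "gf (StB k q 1 1) = (1 + X * (\<Sum>j=1..q. gf (StN j))) + X * (U^2 - U)
        + X * gf (StB (Suc k) q 1 1) + X * ((\<Sum>i=1..<k. gf (StB i 1 0 1)) + gf (StB k 1 0 1))"
      by (subst gf_StB) (simp only: * **, simp add: algebra_simps)
    ultimately show ?thesis unfolding sum_StN_eq using sum_gf_StB_1_0_1[of k] by simp
  qed
  show "U^(q + 1) - U^2 + X^2 * U^3 + U * C^(k + 1) = U^q + X * (U^2 - U) + U * (C^k - 1) +
      X * (\<Sum>j\<in>{Suc k}. U^(q + 1) - U^2 + X^2 * U^3 + U * C^(j + 1))" for k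
  proof -
    have "U * P - U^2 + X^2 * U^3 + U * (C * p) = P + X * (U^2 - U) + U * (p - 1) +
        X * (U * P - U^2 + X^2 * U^3 + U * (C * (C * p)))" for P p
      using XU XC by algebra
    from this[of "U^q" "C^k"] show ?thesis by simp
  qed
qed (use assms in auto)

text \<open>The single further site is near and good, so insertion at \<open>k\<close> reproduces
  the state; hence \<open>k\<close> itself occurs in \<open>J k\<close>.\<close>

lemma gf_StB_1_1_1:
  assumes "0 < k"
  shows "gf (StB k 1 1 1) = X^2 * U * V^2 + U * C^(k + 1)"
proof (rule fps_fixpoint_unique[where f = "\<lambda>k. gf (StB k 1 1 1)" and
      h = "\<lambda>k. X^2 * U * V^2 + U * C^(k + 1)" and
      I = "{0<..}" and J = "\<lambda>k. {k, Suc k}" and a = "\<lambda>k. 1 + X * V + U * (C^(k - 1) - 1)"])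
  show "gf (StB k 1 1 1) = 1 + X * V + U * (C^(k - 1) - 1) + X * (\<Sum>j\<in>{k, Suc k}. gf (StB j 1 1 1))"
    if "k \<in> {0<..}" for k
  proof -
    have "gf (StB k 1 1 1) = 1 + X * V + X * (\<Sum>i=1..<k. gf (StB i 1 0 1)) +
        X * (gf (StB k 1 1 1) + gf (StB (Suc k) 1 1 1))"
      using gf_StQ_1_1 by (subst gf_StB) (simp add: algebra_simps)
    then show ?thesis using sum_gf_StB_1_0_1'[of k] that by simp
  qed
  show "X^2 * U * V^2 + U * C^(k + 1) = 1 + X * V + U * (C^(k - 1) - 1) +
      X * (\<Sum>j\<in>{k, Suc k}. X^2 * U * V^2 + U * C^(j + 1))" if "k \<in> {0<..}" for k
  proof -
    have "X^2 * U * V^2 + U * (C * (C * p)) = 1 + X * V + U * (p - 1) +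
        X * (X^2 * U * V^2 + U * (C * (C * p)) + (X^2 * U * V^2 + U * (C * (C * (C * p)))))" for p
      using XU XV XC by algebra
    note * = this
    obtain m where "k = Suc m" using \<open>k \<in> {0<..}\<close> by (cases k) auto
    then show ?thesis using *[of "C^m"] by (simp add: ac_simps)
  qed
qed (use assms in auto)

text \<open>Insertion at \<open>k\<close> keeps only the highest further site and leads to
  \<open>StB k 1 1 1\<close>. For \<open>n = 0\<close> the formula reduces to that of
  \<open>gf_StB_1_1_1\<close>.\<close>

lemma gf_StB_q_q_1:
  assumes "0 < k"
  shows "gf (StB k (Suc n) (Suc n) 1) = U^(n + 3) + (X^2 * U * V^2 - U^3) + U * C^(k + 1)"
proof (rule fps_fixpoint_unique[where f = "\<lambda>k. gf (StB k (Suc n) (Suc n) 1)" and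
      h = "\<lambda>k. U^(n + 3) + (X^2 * U * V^2 - U^3) + U * C^(k + 1)" and
      I = "{0<..}" and J = "\<lambda>k. {Suc k}" and
      a = "\<lambda>k. 1 + U * (C^(k - 1) - 1) + X * (X^2 * U * V^2 + U * C^(k + 1)) + (U^(n + 1) - U)
        + X * (U^(n + 2) + X^2 * U^2 * V)"])
  show "gf (StB k (Suc n) (Suc n) 1) =
      1 + U * (C^(k - 1) - 1) + X * (X^2 * U * V^2 + U * C^(k + 1)) + (U^(n + 1) - U)
        + X * (U^(n + 2) + X^2 * U^2 * V) + X * (\<Sum>j\<in>{Suc k}. gf (StB j (Suc n) (Suc n) 1))"
    if "k \<in> {0<..}" for k
  proof -
    have *: "(\<Sum>j=1..Suc n. if j \<le> Suc n then gf (StQ j (j - (Suc n - 1))) else gf (StN j)) =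
        (\<Sum>j=1..n. U^(j + 1)) + (U^(n + 2) + X^2 * U^2 * V)"
      by (simp add: gf_StQ_0_eq gf_StQ_Suc_1[simplified])
    have "gf (StB k (Suc n) (Suc n) 1) = 1 + X * (\<Sum>i=1..<k. gf (StB i 1 0 1)) +
        X * gf (StB k 1 1 1) + X * (\<Sum>j=1..n. U^(j + 1)) + X * (U^(n + 2) + X^2 * U^2 * V)
        + X * gf (StB (Suc k) (Suc n) (Suc n) 1)"
      by (subst gf_StB) (simp only: *, simp add: algebra_simps)
    then show ?thesis unfolding sum_U_shift using sum_gf_StB_1_0_1'[of k] gf_StB_1_1_1[of k] that by simp
  qed
  show "U^(n + 3) + (X^2 * U * V^2 - U^3) + U * C^(k + 1) =
      1 + U * (C^(k - 1) - 1) + X * (X^2 * U * V^2 + U * C^(k + 1)) + (U^(n + 1) - U)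
        + X * (U^(n + 2) + X^2 * U^2 * V) +
      X * (\<Sum>j\<in>{Suc k}. U^(n + 3) + (X^2 * U * V^2 - U^3) + U * C^(j + 1))" if "k \<in> {0<..}" for k
  proof -
    have "U^3 * P + (X^2 * U * V^2 - U^3) + U * (C * (C * p)) =
      1 + U * (p - 1) + X * (X^2 * U * V^2 + U * (C * (C * p))) + (U * P - U)
        + X * (U^2 * P + X^2 * U^2 * V) +
      X * (U^3 * P + (X^2 * U * V^2 - U^3) + U * (C * (C * (C * p))))" for P p
      using XU XV XC by algebra
    note * = this
    obtain m where "k = Suc m" using \<open>k \<in> {0<..}\<close> by (cases k) auto
    then show ?thesis using *[of "U^n" "C^m"]
      by (simp add: power_add algebra_simps power2_eq_square power3_eq_cube)
  qed
qed (use assms in auto)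

text \<open>All further sites are good, so insertion at \<open>k\<close> reproduces the state and
  the equation is solved by dividing by \<open>1 - X\<close>. The children at smaller sites have the
  shapes (q,1,1) and (q,0,q), and the lowest further site contributes \<open>V\<close> instead of
  \<open>U\<close>.\<close>

lemma gf_StB_q_1_q:
  assumes "0 < k" "1 < q"
  shows "gf (StB k q 1 q) = X^2 * U^2 * V + X^3 * U^4 + (U^(q + 1) - U^2) * U^k + U * C^(k + 1)"
proof -
  obtain m where m: "k = Suc m" using assms by (cases k) auto
  have *: "(\<Sum>j=1..q. if j \<le> 1 then gf (StQ j (j - (q - q))) else gf (StN j)) =
      V - U + (\<Sum>j=1..q. gf (StN j))"
    using sum_if_le_1[of q "\<lambda>j. gf (StQ j (j - (q - q)))" "\<lambda>j. gf (StN j)"] assms gf_StQ_1_1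
    by (simp add: gf_StN_eq)
  have "gf (StB k q 1 q) = (1 + X * (\<Sum>j=1..q. gf (StN j))) + X * (V - U) + X * gf (StB (Suc k) q 1 1)
      + X * (\<Sum>i=1..<k. gf (StB i q 0 q)) + X * gf (StB k q 1 q)"
    by (subst gf_StB) (simp only: *, simp add: algebra_simps)
  moreover have "X * (\<Sum>i=1..<k. gf (StB i q 0 q)) = (U^(q + 1) - U^2) * (U^m - 1) + U * (C^m - 1)"
  proof -
    have "(\<Sum>i=1..<k. gf (StB i q 0 q)) = (\<Sum>i=1..m. (U^(q + 1) - U^2) * U^i + U * C^(i + 1))"
      unfolding m atLeastLessThanSuc_atLeastAtMost using assms gf_StB_q_0_q
      by (intro sum.cong) auto
    then show ?thesis unfolding sum_U_C[symmetric] by simp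
  qed
  ultimately have "gf (StB k q 1 q) = (U^q + X * (V - U)
      + X * (U^(q + 1) - U^2 + X^2 * U^3 + U * C^(Suc k + 1))
      + ((U^(q + 1) - U^2) * (U^m - 1) + U * (C^m - 1))) + X * gf (StB k q 1 q)"
    unfolding sum_StN_eq using gf_StB_q_1_1[of "Suc k" q] assms by simp
  then have "(1 - X) * gf (StB k q 1 q) = U^q + X * (V - U)
      + X * (U^(q + 1) - U^2 + X^2 * U^3 + U * C^(Suc k + 1))
      + ((U^(q + 1) - U^2) * (U^m - 1) + U * (C^m - 1))"
    unfolding left_diff_distrib by (simp only: diff_eq_eq mult_1)
  from solve_U[OF this] have *: "gf (StB k q 1 q) = U * (U^q + X * (V - U)
      + X * (U^(q + 1) - U^2 + X^2 * U^3 + U * C^(Suc k + 1))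
      + ((U^(q + 1) - U^2) * (U^m - 1) + U * (C^m - 1)))" .
  have "U * (P + X * (V - U) + X * (U * P - U^2 + X^2 * U^3 + U * (C * (C * (C * p))))
      + ((U * P - U^2) * (R - 1) + U * (p - 1))) =
      X^2 * U^2 * V + X^3 * U^4 + (U * P - U^2) * (U * R) + U * (C * (C * p))" for P R p
    using XU XV XC by algebra
  from this[of "U^q" "C^m" "U^m"] show ?thesis unfolding * unfolding m by simp
qed

section \<open>Closed forms for direct sums and decreasing permutations\<close>

text \<open>With \<open>k = Suc m\<close> fixed, the recursion climbs in \<open>q\<close>. Source
  terms constant in \<open>q\<close> acquire the factor \<open>U\<close>, the source
  \<open>C^q\<close> the factor \<open>C\<close>, and the source with \<open>U^(q + 2)\<close> the
  factor \<open>(1 - X) * V\<close>, whose \<open>1 - X\<close> cancels one \<open>U\<close>. The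
  multiple \<open>of_nat m\<close> collects the constant part of \<open>gf_StB_q_1_q\<close> over
  the \<open>m\<close> sites inside the run.\<close>

lemma gf_StE_eq:
  assumes "0 < q"
  shows "gf (StE (Suc m) q) = C^(q + 1) + U * (X * (X^2 * U * V^2 - U^3) + X * U * C^(m + 3)
    + of_nat m * (X * (X^2 * U^2 * V + X^3 * U^4)) - U^2 * (U^m - 1) + U * (C^m - 1))
    + U^(q + 1) * V * (X + U^m - 1)"
proof (rule fps_fixpoint_unique[where f = "\<lambda>q. gf (StE (Suc m) q)" and
      h = "\<lambda>q. C^(q + 1) + U * (X * (X^2 * U * V^2 - U^3) + X * U * C^(m + 3)
        + of_nat m * (X * (X^2 * U^2 * V + X^3 * U^4)) - U^2 * (U^m - 1) + U * (C^m - 1))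
        + U^(q + 1) * V * (X + U^m - 1)" and
      I = "{0<..}" and J = "\<lambda>q. {Suc q}" and
      a = "\<lambda>q. C^q + X * (U^(q + 2) + (X^2 * U * V^2 - U^3) + U * C^(m + 3))
        + of_nat m * (X * (X^2 * U^2 * V + X^3 * U^4)) + (U^(q + 2) - U^2) * (U^m - 1) + U * (C^m - 1)"])
  show "gf (StE (Suc m) q) = C^q + X * (U^(q + 2) + (X^2 * U * V^2 - U^3) + U * C^(m + 3))
        + of_nat m * (X * (X^2 * U^2 * V + X^3 * U^4)) + (U^(q + 2) - U^2) * (U^m - 1) + U * (C^m - 1)
        + X * (\<Sum>j\<in>{Suc q}. gf (StE (Suc m) j))" if "q \<in> {0<..}" for q
  proof -
    obtain n where n: "q = Suc n" using \<open>q \<in> {0<..}\<close> by (cases q) auto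
    have "X * (\<Sum>j=1..q. gf (StP j)) = C^q - 1"
      unfolding gf_StP_eq by (rule sum_C)
    moreover have "gf (StB (Suc (Suc m)) q q 1) = U^(q + 2) + (X^2 * U * V^2 - U^3) + U * C^(m + 3)"
      using gf_StB_q_q_1[of "Suc (Suc m)" n] by (simp add: n eval_nat_numeral)
    moreover have "X * (\<Sum>i=1..<Suc m. gf (StB i (Suc q) 1 (Suc q))) =
        of_nat m * (X * (X^2 * U^2 * V + X^3 * U^4)) + (U^(q + 2) - U^2) * (U^m - 1) + U * (C^m - 1)"
    proof -
      have "(\<Sum>i=1..<Suc m. gf (StB i (Suc q) 1 (Suc q))) =
          (\<Sum>i=1..m. (X^2 * U^2 * V + X^3 * U^4) + ((U^(q + 2) - U^2) * U^i + U * C^(i + 1)))"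
        unfolding atLeastLessThanSuc_atLeastAtMost
      proof (intro sum.cong refl)
        fix i assume "i \<in> {1..m}"
        then show "gf (StB i (Suc q) 1 (Suc q)) =
            (X^2 * U^2 * V + X^3 * U^4) + ((U^(q + 2) - U^2) * U^i + U * C^(i + 1))"
          using gf_StB_q_1_q[of i "Suc q"] n by simp
      qed
      also have "\<dots> = of_nat m * (X^2 * U^2 * V + X^3 * U^4)
          + (\<Sum>i=1..m. (U^(q + 2) - U^2) * U^i + U * C^(i + 1))"
        unfolding sum.distrib[of "\<lambda>_. X^2 * U^2 * V + X^3 * U^4"] by simp
      finally show ?thesis
        by (simp only: distrib_left mult.left_commute[of X "of_nat m"] sum_U_C add.assoc)
    qed
    ultimately show ?thesis
      by (subst gf_StE) (simp only: distrib_left sum.insert sum.empty finite.intros empty_iff, simp)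
  qed
  show "C^(q + 1) + U * (X * (X^2 * U * V^2 - U^3) + X * U * C^(m + 3)
        + of_nat m * (X * (X^2 * U^2 * V + X^3 * U^4)) - U^2 * (U^m - 1) + U * (C^m - 1))
        + U^(q + 1) * V * (X + U^m - 1) =
      C^q + X * (U^(q + 2) + (X^2 * U * V^2 - U^3) + U * C^(m + 3))
        + of_nat m * (X * (X^2 * U^2 * V + X^3 * U^4)) + (U^(q + 2) - U^2) * (U^m - 1) + U * (C^m - 1)
      + X * (\<Sum>j\<in>{Suc q}. C^(j + 1) + U * (X * (X^2 * U * V^2 - U^3) + X * U * C^(m + 3)
        + of_nat m * (X * (X^2 * U^2 * V + X^3 * U^4)) - U^2 * (U^m - 1) + U * (C^m - 1))
        + U^(j + 1) * V * (X + U^m - 1))" for q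
  proof -
    have "C * Q + U * (K + L + M - U^2 * (R - 1) + U * (S - 1)) + U * P * V * (X + R - 1) =
        Q + X * (U^2 * P) + K + L + M + (U^2 * P - U^2) * (R - 1) + U * (S - 1)
        + X * (C * (C * Q) + U * (K + L + M - U^2 * (R - 1) + U * (S - 1)) + U * (U * P) * V * (X + R - 1))"
      for P Q R S K L M
      using XU XV XC by algebra
    from this[of "C^q" "X * (X^2 * U * V^2 - U^3)" "X * U * C^(m + 3)"
      "of_nat m * (X * (X^2 * U^2 * V + X^3 * U^4))" "U^m" "C^m" "U^q"]
    show ?thesis by (simp add: distrib_left power2_eq_square)
  qed
qed (use assms in auto)

text \<open>Here the recursion climbs in \<open>k\<close>, and each source term is again multiplied
  by its own factor. New is a source linear in \<open>k\<close>: \<open>of_nat (k - 1) * c\<close>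
  produces \<open>(of_nat (k - 1) * U + X * U^2) * c\<close>, which explains the second line of the
  formula.\<close>

lemma gf_StD_eq:
  assumes "0 < k"
  shows "gf (StD k) = U * (1 - U + X * C^2 + X * U * (X * (X^2 * U * V^2 - U^3) + U^2 - U) + X * U^2 * V * (X - 1))
    + (of_nat (k - 1) * U + X * U^2) * (X^3 * U * V^2 + X^2 * U * (X^2 * U^2 * V + X^3 * U^4))
    + U * C^k + X * U^2 * (X * C^(k + 3) + C^k) + (X * U^2 * V - X * U^3) * U^(k - 1) * (1 - X) * V"
proof (rule fps_fixpoint_unique[where f = "\<lambda>k. gf (StD k)" and
      h = "\<lambda>k. U * (1 - U + X * C^2 + X * U * (X * (X^2 * U * V^2 - U^3) + U^2 - U) + X * U^2 * V * (X - 1))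
    + (of_nat (k - 1) * U + X * U^2) * (X^3 * U * V^2 + X^2 * U * (X^2 * U^2 * V + X^3 * U^4))
    + U * C^k + X * U^2 * (X * C^(k + 3) + C^k) + (X * U^2 * V - X * U^3) * U^(k - 1) * (1 - X) * V" and
      I = "{0<..}" and J = "\<lambda>k. {Suc k}" and
      a = "\<lambda>k. 1 + of_nat (k - 1) * (X^3 * U * V^2) + U * (C^(k - 1) - 1) + X * gf (StE k 1)"])
  show "gf (StD k) = 1 + of_nat (k - 1) * (X^3 * U * V^2) + U * (C^(k - 1) - 1) + X * gf (StE k 1)
      + X * (\<Sum>j\<in>{Suc k}. gf (StD j))" if "k \<in> {0<..}" for k
  proof -
    obtain m where m: "k = Suc m" using \<open>k \<in> {0<..}\<close> by (cases k) auto
    have "(\<Sum>i=1..<k. gf (StB i 1 1 1)) = (\<Sum>i=1..m. X^2 * U * V^2 + (0 * U^i + U * C^(i + 1)))"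
      unfolding m atLeastLessThanSuc_atLeastAtMost
    proof (intro sum.cong refl)
      fix i assume "i \<in> {1..m}"
      then show "gf (StB i 1 1 1) = X^2 * U * V^2 + (0 * U^i + U * C^(i + 1))"
        using gf_StB_1_1_1[of i] by simp
    qed
    also have "\<dots> = of_nat m * (X^2 * U * V^2) + (\<Sum>i=1..m. 0 * U^i + U * C^(i + 1))"
      unfolding sum.distrib[of "\<lambda>_. X^2 * U * V^2"] by simp
    finally have *: "(\<Sum>i=1..<k. gf (StB i 1 1 1)) =
        of_nat m * (X^2 * U * V^2) + (\<Sum>i=1..m. 0 * U^i + U * C^(i + 1))" .
    have "X * (of_nat m * (X^2 * U * V^2)) = of_nat m * (X^3 * U * V^2)"
      by (simp add: eval_nat_numeral algebra_simps)
    then have "X * (\<Sum>i=1..<k. gf (StB i 1 1 1)) = of_nat m * (X^3 * U * V^2) + U * (C^m - 1)"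
      unfolding * distrib_left sum_U_C by simp
    then show ?thesis using gf_StD[of k] m by (simp add: distrib_left)
  qed
  show "U * (1 - U + X * C^2 + X * U * (X * (X^2 * U * V^2 - U^3) + U^2 - U) + X * U^2 * V * (X - 1))
    + (of_nat (k - 1) * U + X * U^2) * (X^3 * U * V^2 + X^2 * U * (X^2 * U^2 * V + X^3 * U^4))
    + U * C^k + X * U^2 * (X * C^(k + 3) + C^k) + (X * U^2 * V - X * U^3) * U^(k - 1) * (1 - X) * V =
      1 + of_nat (k - 1) * (X^3 * U * V^2) + U * (C^(k - 1) - 1) + X * gf (StE k 1)
      + X * (\<Sum>k\<in>{Suc k}. U * (1 - U + X * C^2 + X * U * (X * (X^2 * U * V^2 - U^3) + U^2 - U) + X * U^2 * V * (X - 1))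
    + (of_nat (k - 1) * U + X * U^2) * (X^3 * U * V^2 + X^2 * U * (X^2 * U^2 * V + X^3 * U^4))
    + U * C^k + X * U^2 * (X * C^(k + 3) + C^k) + (X * U^2 * V - X * U^3) * U^(k - 1) * (1 - X) * V)"
    if "k \<in> {0<..}" for k
  proof -
    obtain m where m: "k = Suc m" using \<open>k \<in> {0<..}\<close> by (cases k) auto
    \<comment> \<open>The letters \<open>p\<close>, \<open>R\<close> and \<open>M\<close> stand for
      \<open>C^m\<close>, \<open>U^m\<close> and \<open>of_nat m\<close>, while \<open>K1\<close>
      and \<open>K2\<close> abbreviate constants inherited from \<open>StB\<close>.\<close>
    have "U * (1 - U + X * C^2 + X * U * (X * K1 + U^2 - U) + X * U^2 * V * (X - 1))
      + (M * U + X * U^2) * (X^3 * U * V^2 + X^2 * U * K2)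
      + U * (C * p) + X * U^2 * (X * (C^4 * p) + C * p) + (X * U^2 * V - X * U^3) * R * (1 - X) * V =
      1 + M * (X^3 * U * V^2) + U * (p - 1)
      + X * (C^2 + U * (X * K1 + X * U * (C^3 * p) + M * (X * K2) - U^2 * (R - 1) + U * (p - 1))
        + U^2 * V * (X + R - 1))
      + X * (U * (1 - U + X * C^2 + X * U * (X * K1 + U^2 - U) + X * U^2 * V * (X - 1))
      + ((1 + M) * U + X * U^2) * (X^3 * U * V^2 + X^2 * U * K2)
      + U * (C * (C * p)) + X * U^2 * (X * (C^5 * p) + C * (C * p)) + (X * U^2 * V - X * U^3) * (U * R) * (1 - X) * V)"
      for K1 K2 M p R
      using XU XV XC by algebra
    from this[of "X^2 * U * V^2 - U^3" "of_nat m" "X^2 * U^2 * V + X^3 * U^4" "C^m" "U^m"]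
    show ?thesis unfolding m gf_StE_eq[of 1, simplified, folded One_nat_def]
      by (simp add: eval_nat_numeral mult.assoc)
  qed
qed (use assms in auto)

lemma avoiders_gf_eq: "avoiders_gf {[1,2,3,4], [2,3,4,1], [4,1,2,3]} = gf (StD 0)"
  unfolding avoiders_gf_def gf_def card_avoiders_tree_count ..

theorem theorem3p29:
  shows "avoiders_gf {[1,2,3,4], [2,3,4,1], [4,1,2,3]} =
    (1 - 11 * fps_X + 51 * fps_X ^ 2 - 130 * fps_X ^ 3 + 199 * fps_X ^ 4 - 183 * fps_X ^ 5
       + 91 * fps_X ^ 6 - 15 * fps_X ^ 7 - 6 * fps_X ^ 8 + 4 * fps_X ^ 9)
      / ((1 - fps_X) ^ 7 * (1 - 2 * fps_X) ^ 2)
    + (1 + fps_X) / (1 - fps_X) * (catalan_gf - 1)"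
proof -
  let ?N = "1 - 11 * X + 51 * X^2 - 130 * X^3 + 199 * X^4 - 183 * X^5
       + 91 * X^6 - 15 * X^7 - 6 * X^8 + 4 * X^9"
  have D: "gf (StD 1) = U * (1 - U + X * C^2 + X * U * (X * (X^2 * U * V^2 - U^3) + U^2 - U) + X * U^2 * V * (X - 1))
    + X * U^2 * (X^3 * U * V^2 + X^2 * U * (X^2 * U^2 * V + X^3 * U^4))
    + U * C + X * U^2 * (X * C^4 + C) + (X * U^2 * V - X * U^3) * (1 - X) * V"
    using gf_StD_eq[of 1] by simp
  have "?N / ((1 - X)^7 * (1 - 2 * X)^2) = ?N * (U^7 * V^2)"
    by (simp add: fps_divide_unit U_def V_def fps_inverse_mult fps_inverse_power)
  moreover have "(1 + X) / (1 - X) = (1 + X) * U"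
    by (simp add: fps_divide_unit U_def)
  \<comment> \<open>Once the denominators are written through \<open>U\<close> and \<open>V\<close>,
    the claim is a polynomial identity modulo \<open>XU\<close>, \<open>XV\<close> and
    \<open>XC\<close>.\<close>
  moreover have "gf (StD 0) = ?N * (U^7 * V^2) + (1 + X) * U * (C - 1)"
    unfolding gf_StD_0 D using XU XV XC by algebra
  ultimately show ?thesis unfolding avoiders_gf_eq by simp
qed

end
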